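(* Let $f$ be a polynomial with rational coefficients of degree at least $2$ such that $f(n)\in\mathbb{N}$ for every $n\in\mathbb{N}$, and let $q\ge 2$ be an integer. Then the language consisting of the base-$q$ representations of the numbers in $\{f(n)\mid n\in\mathbb{N}\}$ is not context-free.
   Context: A polynomial over $\mathbb{Q}$ is called natural if it takes values in $\mathbb{N}$ at all natural numbers; it is linear if its degree is at most one, and non-linear otherwise. The base-$q$ representation of a natural number is its usual digit string over the alphabet $\{0,1,\dots,q-1\}$ (without leading zeros). *)

theory Defs
  imports "HOL-Computational_Algebra.Polynomial"
begin

datatype ('n, 't) symbol = NonTerm 'n | Term 't

inductive derivation_step ::
  "('n \<times> ('n, 't) symbol list) set \<Rightarrow> ('n, 't) symbol list \<Rightarrow> ('n, 't) symbol list \<Rightarrow> bool"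
  for P where
  "(A, w) \<in> P \<Longrightarrow> derivation_step P (u @ [NonTerm A] @ v) (u @ w @ v)"

definition grammar_language :: "('n \<times> ('n, 't) symbol list) set \<Rightarrow> 'n \<Rightarrow> 't list set" where
  "grammar_language P S = {w. (derivation_step P)\<^sup>*\<^sup>* [NonTerm S] (map Term w)}"

(* A grammar is given by its finite set P of productions and its start symbol S; its nonterminals
   and terminals are S and the symbols occurring in P, hence finitely many.  Nonterminals are
   natural numbers without loss of generality: finitely many nonterminals can be renamed. *)
definition context_free :: "'t list set \<Rightarrow> bool" where
  "context_free L \<longleftrightarrow>
     (\<exists>(P :: (nat \<times> (nat, 't) symbol list) set) S. finite P \<and> L = grammar_language P S)"

(* Most significant digit first; the representation of 0 is the one-digit string [0].
   The disjunct q < 2 only serves termination. *)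
fun base_rep :: "nat \<Rightarrow> nat \<Rightarrow> nat list" where
  "base_rep q n = (if q < 2 \<or> n < q then [n] else base_rep q (n div q) @ [n mod q])"

declare base_rep.simps [simp del]

lemma horner_sum_base_rep: "horner_sum (\<lambda>d. d) q (rev (base_rep q n)) = n"
  by (induction q n rule: base_rep.induct) (subst base_rep.simps, auto)

lemma set_base_rep: "q \<ge> 2 \<Longrightarrow> set (base_rep q n) \<subseteq> {..<q}"
  by (induction q n rule: base_rep.induct) (subst base_rep.simps, auto)

lemma base_rep_no_leading_zero: "n > 0 \<Longrightarrow> base_rep q n \<noteq> [] \<and> hd (base_rep q n) \<noteq> 0"
  by (induction q n rule: base_rep.induct) (subst (1 2) base_rep.simps, auto simp: div_greater_zero_iff)

definition natural_poly :: "rat poly \<Rightarrow> bool" where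
  "natural_poly f \<longleftrightarrow> (\<forall>n::nat. poly f (of_nat n) \<in> \<nat>)"

end

theory Submission
  imports Defs Complex_Main "HOL-Computational_Algebra.Primes"
begin

text \<open>
  Let \<open>d\<close> be the degree and \<open>c\<close> the leading coefficient of \<open>f\<close>, and put \<open>\<sigma> = c\<^sub>d\<^sub>-\<^sub>1 / (d c)\<close>, where \<open>c\<^sub>d\<^sub>-\<^sub>1\<close>
  is the coefficient of degree \<open>d - 1\<close>. A pumping lemma whose pumped length is divisible by \<open>d\<close> produces
  numbers \<open>n\<^sub>i\<close> with \<open>f(n\<^sub>i) = P(q\<^sup>i)\<close> for all \<open>i\<close>, where
  \<open>P(y) = \<alpha> y\<^sup>d\<^sup>A + \<beta> y\<^sup>b + \<gamma>\<close>. Since \<open>deg f\<close> divides \<open>deg P\<close>, some real polynomial \<open>g\<close>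
  satisfies \<open>n\<^sub>i - g(q\<^sup>i) \<longlonglongrightarrow> 0\<close>, and integrality improves this to \<open>f \<circ> g = P\<close>. A composition
  with at most three terms forces \<open>g(y) = r y\<^sup>A + s\<close>, with \<open>s = - \<sigma>\<close> or \<open>\<beta> = d c r\<^sup>d\<^sup>-\<^sup>1 (s + \<sigma>)\<close>.
  With \<open>T = q\<^sup>A\<close> this gives \<open>n\<^sub>1 - s = T (n\<^sub>0 - s)\<close>. The number \<open>n\<^sub>1\<close> is ours to choose: we take the numerator
  of \<open>n\<^sub>1 + \<sigma>\<close> coprime to \<open>q\<close>, which excludes \<open>s = - \<sigma>\<close>; in the other case, comparing the
  divisibility of \<open>\<beta>\<close> by powers of \<open>q\<close> with its size bounds \<open>r\<close>, hence also \<open>n\<^sub>1\<close>.\<close>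

subsection \<open>The pumping lemma\<close>

abbreviation derives :: "('n \<times> ('n, 't) symbol list) set \<Rightarrow> ('n, 't) symbol list \<Rightarrow> ('n, 't) symbol list \<Rightarrow> bool"
  where "derives P \<equiv> (derivation_step P)\<^sup>*\<^sup>*"

lemma derivation_step_context:
  "derivation_step P x y \<Longrightarrow> derivation_step P (u @ x @ v) (u @ y @ v)"
proof (induction rule: derivation_step.induct)
  case (1 A w u' v')
  then show ?case using derivation_step.intros[of A w P "u @ u'" "v' @ v"] by simp
qed

lemma derives_context: "derives P x y \<Longrightarrow> derives P (u @ x @ v) (u @ y @ v)"
  by (induction rule: rtranclp_induct) (auto intro: rtranclp.rtrancl_into_rtrancl derivation_step_context)

lemma derives_production: "(A, w) \<in> P \<Longrightarrow> derives P [NonTerm A] w"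
  using derivation_step.intros[of A w P "[]" "[]"] by auto

lemma derives_append:
  assumes "derives P x x'" "derives P y y'"
  shows "derives P (x @ y) (x' @ y')"
  using derives_context[OF assms(1), of "[]" y] derives_context[OF assms(2), of x' "[]"] by simp

text \<open>A parse tree is recorded only through its root symbol and its yield. Unlike a derivation
  sequence, it gives access to the subtree below each symbol of a production, with an induction
  hypothesis for each child.\<close>

inductive parses :: "('n \<times> ('n, 't) symbol list) set \<Rightarrow> ('n, 't) symbol \<Rightarrow> 't list \<Rightarrow> bool" for P where
  parses_Term: "parses P (Term t) [t]"
| parses_NonTerm: "(A, xs) \<in> P \<Longrightarrow> list_all2 (parses P) xs ws \<Longrightarrow> parses P (NonTerm A) (concat ws)"
monos list_all2_mono

lemma list_all2_parses_Terms: "list_all2 (parses P) (map Term w) (map (\<lambda>t. [t]) w)"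
  by (induction w) (auto intro: parses_Term)

text \<open>Induction from the end of the derivation: undoing a step merges the trees over the
  right-hand side into one tree over the nonterminal.\<close>

lemma list_all2_parses_derives:
  assumes "derives P x (map Term w)"
  shows "\<exists>ws. list_all2 (parses P) x ws \<and> concat ws = w"
  using assms
proof (induction rule: converse_rtranclp_induct)
  case base
  show ?case using list_all2_parses_Terms[of P w] by (intro exI[of _ "map (\<lambda>t. [t]) w"]) auto
next
  case (step x y)
  from step.hyps(1) show ?case
  proof cases
    case (1 A rhs u v)
    from step.IH obtain ws where ws: "list_all2 (parses P) (u @ rhs @ v) ws" "concat ws = w"
      using 1 by auto
    then obtain us rs vs where "ws = us @ rs @ vs" "list_all2 (parses P) u us"
      "list_all2 (parses P) rhs rs" "list_all2 (parses P) v vs"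
      by (auto simp: list_all2_append1)
    with 1 ws have "list_all2 (parses P) x (us @ [concat rs] @ vs)"
      by (auto intro!: list_all2_appendI parses_NonTerm)
    moreover have "concat (us @ [concat rs] @ vs) = w"
      using ws \<open>ws = us @ rs @ vs\<close> by simp
    ultimately show ?thesis by blast
  qed
qed

lemma parses_if_derives:
  "derives P [X] (map Term w) \<Longrightarrow> parses P X w"
  using list_all2_parses_derives[of P "[X]" w] by (auto simp: list_all2_Cons1)

lemma derives_concat:
  "list_all2 (\<lambda>X w. derives P [X] (map Term w)) xs ws \<Longrightarrow> derives P xs (map Term (concat ws))"
proof (induction rule: list_all2_induct)
  case (Cons x xs y ys)
  then show ?case using derives_append[of P "[x]" "map Term y" xs "map Term (concat ys)"] by simp
qed auto

lemma derives_if_parses: "parses P X w \<Longrightarrow> derives P [X] (map Term w)"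
proof (induction rule: parses.induct)
  case (parses_NonTerm A xs ws)
  then have "list_all2 (\<lambda>X w. derives P [X] (map Term w)) xs ws"
    by (auto elim: list_all2_mono)
  from derives_concat[OF this] derives_production[OF parses_NonTerm(1)] show ?case
    by (meson rtranclp_trans)
qed auto

section \<open>Long paths in parse trees\<close>

definition derives_around :: "('n \<times> ('n, 't) symbol list) set \<Rightarrow> 'n \<Rightarrow> 't list \<Rightarrow> 'n \<Rightarrow> 't list \<Rightarrow> bool" where
  "derives_around P A u C z \<longleftrightarrow> derives P [NonTerm A] (map Term u @ [NonTerm C] @ map Term z)"

lemma derives_around_refl: "derives_around P A [] A []"
  by (simp add: derives_around_def)

lemma derives_around_trans:
  assumes "derives_around P A u C z" "derives_around P C u' E z'"
  shows "derives_around P A (u @ u') E (z' @ z)"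
  using assms(1) derives_context[OF assms(2)[unfolded derives_around_def], of "map Term u" "map Term z"]
  unfolding derives_around_def by simp

lemma derives_around_power:
  assumes "derives_around P C v C y"
  shows "derives_around P C (concat (replicate i v)) C (concat (replicate i y))"
proof (induction i)
  case (Suc i)
  have "concat (replicate i y) @ y = y @ concat (replicate i y)"
    by (induction i) auto
  then show ?case using derives_around_trans[OF assms Suc] by simp
qed (simp add: derives_around_refl)

lemma derives_around_parses:
  assumes "derives_around P A u C z" "parses P (NonTerm C) w"
  shows "derives P [NonTerm A] (map Term (u @ w @ z))"
  using assms(1) derives_context[OF derives_if_parses[OF assms(2)], of "map Term u" "map Term z"]
  unfolding derives_around_def by auto

text \<open>A proper descendant of a parse tree node; requiring a strictly shorter yield makes the
  pumped part nonempty without any minimality assumption on the tree.\<close>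

definition descends :: "('n \<times> ('n, 't) symbol list) set \<Rightarrow> 'n \<times> 't list \<Rightarrow> 'n \<times> 't list \<Rightarrow> bool" where
  "descends P = (\<lambda>(A, w) (C, w'). \<exists>u z. w = u @ w' @ z \<and> derives_around P A u C z \<and>
     length w' < length w \<and> parses P (NonTerm C) w')"

lemma descends_trans: "descends P x y \<Longrightarrow> descends P y z \<Longrightarrow> descends P x z"
proof -
  assume xy: "descends P x y" and yz: "descends P y z"
  obtain A w C w' E w'' where eq: "x = (A, w)" "y = (C, w')" "z = (E, w'')"
    by (cases x, cases y, cases z)
  obtain u t where 1: "w = u @ w' @ t" "derives_around P A u C t" "length w' < length w"
    using xy by (auto simp: eq descends_def)
  obtain u' t' where 2: "w' = u' @ w'' @ t'" "derives_around P C u' E t'" "length w'' < length w'"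
    "parses P (NonTerm E) w''"
    using yz by (auto simp: eq descends_def)
  have "w = (u @ u') @ w'' @ (t' @ t)" "length w'' < length w" using 1 2 by auto
  then show ?thesis using derives_around_trans[OF 1(2) 2(2)] 2(4) unfolding eq descends_def prod.case
    by (intro exI[of _ "u @ u'"] exI[of _ "t' @ t"]) auto
qed

lemma long_concat_member:
  assumes "length ws \<le> B" "B > 0"
  shows "ws = [] \<or> (\<exists>w \<in> set ws. length (concat ws) \<le> B * length w)"
proof (cases "ws = []")
  case False
  define k where "k = Max (length ` set ws)"
  have "k \<in> length ` set ws" unfolding k_def using False by (intro Max_in) auto
  then obtain w where w: "w \<in> set ws" "k = length w" by auto
  have "length (concat ws) = sum_list (map length ws)" by (simp add: length_concat)
  also have "\<dots> \<le> sum_list (map (\<lambda>_. k) ws)"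
    by (intro sum_list_mono) (auto simp: k_def)
  also have "\<dots> \<le> B * k" using assms by (simp add: sum_list_triv)
  finally show ?thesis using w by auto
qed auto

text \<open>Go to the child with the longest yield: at most a factor \<open>B\<close> of the length
  is lost. If that child already has the whole yield, no strict descent has happened yet, and the
  induction hypothesis continues below it.\<close>

lemma ex_descends:
  assumes "parses P X w" and rhs: "\<forall>(A, xs) \<in> P. length xs \<le> B"
    and "B > 0" "length w > B"
  shows "\<exists>A. X = NonTerm A \<and> (\<exists>C w'. descends P (A, w) (C, w') \<and> length w \<le> B * length w')"
  using assms(1,4)
proof (induction rule: parses.induct)
  case (parses_Term t)
  then show ?case using \<open>B > 0\<close> by simp
next
  case (parses_NonTerm A xs ws)
  have len: "length xs = length ws" using parses_NonTerm(2) by (rule list_all2_lengthD)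
  have "length ws \<le> B" using rhs parses_NonTerm(1) len by auto
  moreover have "ws \<noteq> []" using parses_NonTerm(3) by auto
  ultimately obtain w where w: "w \<in> set ws" "length (concat ws) \<le> B * length w"
    using long_concat_member[OF _ \<open>B > 0\<close>] by blast
  then obtain i where i: "i < length ws" "w = ws ! i" by (auto simp: in_set_conv_nth)
  have split_ws: "ws = take i ws @ [w] @ drop (Suc i) ws" using i id_take_nth_drop by auto
  have split_xs: "xs = take i xs @ [xs ! i] @ drop (Suc i) xs" using i len id_take_nth_drop[of i xs] by auto
  have w_parse: "parses P (xs ! i) w"
    and IH: "length w > B \<Longrightarrow> \<exists>A. xs ! i = NonTerm A \<and> (\<exists>C w'. descends P (A, w) (C, w') \<and> length w \<le> B * length w')"
    using parses_NonTerm(2) i len by (auto simp: list_all2_conv_all_nth)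
  \<comment> \<open>A child of length 1 would bound the whole yield by \<open>B\<close>; hence the
    chosen child is not a terminal.\<close>
  have "length w \<noteq> 1" using w(2) parses_NonTerm(3) by auto
  then obtain C where C: "xs ! i = NonTerm C" using w_parse by (cases "xs ! i") (auto elim: parses.cases)
  let ?u = "concat (take i ws)" and ?z = "concat (drop (Suc i) ws)"
  have ders: "list_all2 (\<lambda>X w. derives P [X] (map Term w)) xs ws"
    using parses_NonTerm(2) by (auto elim!: list_all2_mono intro: derives_if_parses)
  have "derives P (take i xs) (map Term ?u)" "derives P (drop (Suc i) xs) (map Term ?z)"
    using ders by (auto intro!: derives_concat list_all2_takeI list_all2_dropI)
  then have "derives P (take i xs @ [xs ! i] @ drop (Suc i) xs) (map Term ?u @ [NonTerm C] @ map Term ?z)"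
    using C by (intro derives_append) auto
  then have around: "derives_around P A ?u C ?z"
    using derives_production[OF parses_NonTerm(1)] split_xs unfolding derives_around_def by auto
  have cw: "concat ws = ?u @ w @ ?z" by (subst split_ws) simp
  show ?case
  proof (cases "length w < length (concat ws)")
    case True
    then have "descends P (A, concat ws) (C, w)"
      using cw around w_parse C unfolding descends_def by auto
    then show ?thesis using w(2) by blast
  next
    case False
    then have "length ?u = 0" "length ?z = 0" using arg_cong[OF cw, of length] by simp_all
    then have empty: "?u = []" "?z = []" by (simp_all only: length_0_conv)
    then have eq: "concat ws = w" using cw by (simp only: append_Nil append_Nil2)
    then obtain E w' where E: "descends P (C, w) (E, w')" "length w \<le> B * length w'"
      using IH parses_NonTerm(3) C eq by auto
    from around have "derives_around P A [] C []" unfolding empty .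
    then have "descends P (A, w) (E, w')"
      using E(1) derives_around_trans[of P A "[]" C "[]"] unfolding descends_def by fastforce
    then show ?thesis unfolding eq using E(2) by blast
  qed
qed

text \<open>Each descent divides the length by at most \<open>B\<close>, so a yield longer than
  \<open>B ^ n\<close> allows \<open>n\<close> of them.\<close>

lemma ex_descending_chain:
  assumes rhs: "\<forall>(A, xs) \<in> P. length xs \<le> B" and "B > 1"
    and "parses P (NonTerm A) w" "length w > B ^ n"
  shows "\<exists>node. node 0 = (A, w) \<and> (\<forall>i<n. descends P (node i) (node (Suc i)))"
  using assms(3,4)
proof (induction n arbitrary: A w)
  case 0
  then show ?case by (intro exI[of _ "\<lambda>_. (A, w)"]) auto
next
  case (Suc n)
  have "B \<le> B * B ^ n" using \<open>B > 1\<close> by simp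
  then have "length w > B" using Suc.prems(2) by (simp only: power_Suc)
  then obtain C w' where C: "descends P (A, w) (C, w')" "length w \<le> B * length w'"
    using ex_descends[OF Suc.prems(1) rhs] \<open>B > 1\<close> by auto
  have "B * B ^ n < B * length w'" using C(2) Suc.prems(2)[unfolded power_Suc] by linarith
  then have "length w' > B ^ n" by simp
  moreover have "parses P (NonTerm C) w'" using C(1) by (auto simp: descends_def)
  ultimately obtain node where "node 0 = (C, w')" "\<forall>i<n. descends P (node i) (node (Suc i))"
    using Suc.IH by blast
  then show ?case using C(1)
    by (intro exI[of _ "\<lambda>i. case i of 0 \<Rightarrow> (A, w) | Suc j \<Rightarrow> node j"])
       (auto split: nat.splits simp: less_Suc_eq_0_disj)
qed

lemma descending_chain_less:
  assumes "\<forall>i<n. descends P (node i) (node (Suc i))" "i < j" "j \<le> n"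
  shows "descends P (node i) (node j)"
  using assms(2,3)
proof (induction j)
  case (Suc j)
  then show ?case using assms(1) descends_trans[of P "node i" "node j"] by (cases "i = j") auto
qed simp

text \<open>The same descent, stopped as soon as the yield is at most \<open>B ^ Suc n\<close>:
  losing at most a factor \<open>B\<close>, it cannot jump below \<open>B ^ n\<close>. The upper
  bound is what limits \<open>v @ x @ y\<close> in the pumping lemma.\<close>

lemma ex_subtree_of_bounded_length:
  assumes rhs: "\<forall>(A, xs) \<in> P. length xs \<le> B" and "B > 1"
    and "parses P (NonTerm A) w" "length w > B ^ n"
  shows "\<exists>u C w' z. w = u @ w' @ z \<and> derives_around P A u C z \<and> parses P (NonTerm C) w' \<and>
           B ^ n < length w' \<and> length w' \<le> B ^ Suc n"
  using assms(3,4)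
proof (induction "length w" arbitrary: A w rule: less_induct)
  case less
  show ?case
  proof (cases "length w \<le> B ^ Suc n")
    case True
    with less.prems show ?thesis
      by (intro exI[of _ "[]"] exI[of _ A] exI[of _ w]) (auto simp: derives_around_refl)
  next
    case False
    have "B \<le> B * B ^ n" using \<open>B > 1\<close> by simp
    then have "length w > B" using False by (simp only: power_Suc not_le)
    then obtain C w' where C: "descends P (A, w) (C, w')" "length w \<le> B * length w'"
      using ex_descends[OF less.prems(1) rhs] \<open>B > 1\<close> by auto
    have "B * B ^ n < B * length w'" using C(2) False[unfolded power_Suc] by linarith
    then have "length w' > B ^ n" by simp
    moreover obtain u z where uz: "w = u @ w' @ z" "derives_around P A u C z"
      "length w' < length w" "parses P (NonTerm C) w'" using C(1) by (auto simp: descends_def)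
    ultimately obtain u' E w'' z' where
      "w' = u' @ w'' @ z'" "derives_around P C u' E z'" "parses P (NonTerm E) w''"
      "B ^ n < length w''" "length w'' \<le> B ^ Suc n"
      using less.hyps[of w' C] by blast
    then show ?thesis using uz derives_around_trans[OF uz(2), of u' E z']
      by (intro exI[of _ "u @ u'"] exI[of _ E] exI[of _ w''] exI[of _ "z' @ z"]) auto
  qed
qed

text \<open>The pigeonhole principle is applied to the pairs of a nonterminal and the length of its
  yield modulo \<open>d\<close>, which forces \<open>d\<close> to divide the pumped length.\<close>

theorem pumping_lemma_dvd:
  fixes L :: "'t list set"
  assumes "context_free L" "d > 0"
  shows "\<exists>p. \<forall>w\<in>L. length w > p \<longrightarrow>
    (\<exists>u v x y z. w = u @ v @ x @ y @ z \<and> length (v @ x @ y) \<le> p \<and> 0 < length v + length y \<and>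
       d dvd length v + length y \<and>
       (\<forall>i. u @ concat (replicate i v) @ x @ concat (replicate i y) @ z \<in> L))"
proof -
  obtain P :: "(nat \<times> (nat, 't) symbol list) set" and S where P: "finite P" "L = grammar_language P S"
    using assms(1) by (auto simp: context_free_def)
  define B where "B = Max (insert 2 ((\<lambda>(A, xs). length xs) ` P))"
  have B: "B > 1" "\<forall>(A, xs) \<in> P. length xs \<le> B"
  proof -
    have "2 \<le> B" unfolding B_def using P(1) by (intro Max_ge) auto
    then show "B > 1" by simp
    show "\<forall>(A, xs) \<in> P. length xs \<le> B"
      unfolding B_def using P(1) by (auto intro!: Max_ge)
  qed
  define labels where "labels = fst ` P \<times> {..<d}"
  have "finite labels" using P(1) by (simp add: labels_def)
  \<comment> \<open>A chain of \<open>n\<close> descents has \<open>n + 1\<close> nodes, one more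
    than there are labels.\<close>
  define n where "n = card labels"
  show ?thesis
  proof (intro exI[of _ "B ^ Suc n"] ballI impI)
    fix w assume w: "w \<in> L" "length w > B ^ Suc n"
    then have "parses P (NonTerm S) w" using P(2) parses_if_derives by (auto simp: grammar_language_def)
    moreover have "length w > B ^ n"
      using w(2) B(1) by (meson le_less_trans lessI less_imp_le power_increasing)
    ultimately obtain u0 C0 w0 z0 where 0: "w = u0 @ w0 @ z0" "derives_around P S u0 C0 z0"
      "parses P (NonTerm C0) w0" "B ^ n < length w0" "length w0 \<le> B ^ Suc n"
      using ex_subtree_of_bounded_length[of P B S w n] B by blast
    obtain node where node: "node 0 = (C0, w0)" "\<forall>i<n. descends P (node i) (node (Suc i))"
      using ex_descending_chain[of P B C0 w0 n] B 0 by blast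
    have parses_node: "parses P (NonTerm (fst (node i))) (snd (node i))" if "i \<le> n" for i
    proof (cases i)
      case 0 with node \<open>parses P (NonTerm C0) w0\<close> show ?thesis by simp
    next
      case (Suc j)
      then have "descends P (node j) (node i)" using node(2) that by auto
      then show ?thesis by (auto simp: descends_def split: prod.splits)
    qed
    define label where "label i = (fst (node i), length (snd (node i)) mod d)" for i
    have "label ` {..n} \<subseteq> labels"
    proof
      fix l assume "l \<in> label ` {..n}"
      then obtain i where i: "i \<le> n" "l = label i" by auto
      from parses_node[OF i(1)] have "fst (node i) \<in> fst ` P"
        by (auto elim!: parses.cases simp: image_iff) force
      then show "l \<in> labels" using i assms(2) by (auto simp: labels_def label_def)
    qed
    then have "card (label ` {..n}) < card {..n}"
      using card_mono[OF \<open>finite labels\<close>] by (simp add: n_def le_imp_less_Suc)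
    then have "\<not> inj_on label {..n}" using card_image by force
    then obtain i j where ij: "i < j" "j \<le> n" "label i = label j"
      unfolding inj_on_def by (metis atMost_iff nat_neq_iff)
    obtain C x1 where Ci: "node i = (C, x1)" by (cases "node i")
    obtain x2 where Cj: "node j = (C, x2)" using ij(3) Ci by (cases "node j") (auto simp: label_def)
    have "descends P (node i) (node j)" using descending_chain_less[OF node(2)] ij by simp
    then obtain v y where vy: "x1 = v @ x2 @ y" "derives_around P C v C y" "length x2 < length x1"
      "parses P (NonTerm C) x2" by (auto simp: Ci Cj descends_def)
    obtain u1 z1 where 1: "w0 = u1 @ x1 @ z1" "derives_around P C0 u1 C z1"
    proof (cases "i = 0")
      case True then show ?thesis using Ci node(1) that[of "[]" "[]"] by (simp add: derives_around_refl)
    next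
      case False
      then have "descends P (node 0) (node i)" using descending_chain_less[OF node(2)] ij by simp
      then show ?thesis using that by (auto simp: node(1) Ci descends_def)
    qed
    \<comment> \<open>Equal labels give equal residues, and \<open>length x1 - length x2\<close> is
      the pumped length.\<close>
    have "length x1 mod d = length x2 mod d" using ij(3) by (simp add: label_def Ci Cj)
    then have "d dvd length v + length y"
      using vy(1,3) mod_eq_dvd_iff_nat[of "length x2" "length x1" d] by simp
    moreover have "u0 @ u1 @ concat (replicate k v) @ x2 @ concat (replicate k y) @ z1 @ z0 \<in> L" for k
      using derives_around_parses[OF derives_around_trans[OF derives_around_trans[OF 0(2) 1(2)]
        derives_around_power[OF vy(2), of k]] vy(4)]
      unfolding P(2) grammar_language_def by simp
    ultimately show "\<exists>u v x y z. w = u @ v @ x @ y @ z \<and> length (v @ x @ y) \<le> B ^ Suc n \<and>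
        0 < length v + length y \<and> d dvd length v + length y \<and>
        (\<forall>i. u @ concat (replicate i v) @ x @ concat (replicate i y) @ z \<in> L)"
      using 0(1,5) 1(1) vy(1,3)
      by (intro exI[of _ "u0 @ u1"] exI[of _ v] exI[of _ x2] exI[of _ y] exI[of _ "z1 @ z0"]) auto
  qed
qed

text \<open>When \<open>v\<close> is empty, \<open>y\<close> takes over its role. A nonempty
  \<open>v\<close> makes the exponent \<open>length y\<close> in the pumped values strictly smaller
  than the top exponent \<open>length v + length y\<close>.\<close>

lemma pumping_lemma_nonempty_left:
  fixes L :: "'t list set"
  assumes "context_free L" "d > 0"
  shows "\<exists>p. \<forall>w\<in>L. length w > p \<longrightarrow>
    (\<exists>u v x y z. w = u @ v @ x @ y @ z \<and> length (v @ x @ y) \<le> p \<and> v \<noteq> [] \<and>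
       d dvd length v + length y \<and>
       (\<forall>i. u @ concat (replicate i v) @ x @ concat (replicate i y) @ z \<in> L))"
proof -
  obtain p where p: "\<forall>w\<in>L. length w > p \<longrightarrow>
    (\<exists>u v x y z. w = u @ v @ x @ y @ z \<and> length (v @ x @ y) \<le> p \<and> 0 < length v + length y \<and>
       d dvd length v + length y \<and>
       (\<forall>i. u @ concat (replicate i v) @ x @ concat (replicate i y) @ z \<in> L))"
    using pumping_lemma_dvd[OF assms] by blast
  show ?thesis
  proof (intro exI[of _ p] ballI impI)
    fix w assume "w \<in> L" "length w > p"
    then obtain u v x y z where w: "w = u @ v @ x @ y @ z" "length (v @ x @ y) \<le> p"
      "0 < length v + length y" "d dvd length v + length y"
      "\<And>i. u @ concat (replicate i v) @ x @ concat (replicate i y) @ z \<in> L"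
      using p by meson
    show "\<exists>u v x y z. w = u @ v @ x @ y @ z \<and> length (v @ x @ y) \<le> p \<and> v \<noteq> [] \<and>
       d dvd length v + length y \<and>
       (\<forall>i. u @ concat (replicate i v) @ x @ concat (replicate i y) @ z \<in> L)"
    proof (cases "v = []")
      case True
      have "concat (replicate i []) = []" for i by (induction i) auto
      then show ?thesis using True w
        by (intro exI[of _ "u @ x"] exI[of _ y] exI[of _ "[]"] exI[of _ "[]"] exI[of _ z]) auto
    next
      case False
      then show ?thesis using w by blast
    qed
  qed
qed

subsection \<open>Polynomials with few terms at powers of an integer\<close>

lemma coeff_mult_le_degree:
  fixes p q :: "'a::idom poly"
  assumes "degree p \<le> m" "degree q \<le> n"
  shows "coeff (p * q) (m + n) = coeff p m * coeff q n"
proof (cases "degree p = m \<and> degree q = n")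
  case True
  then show ?thesis using coeff_mult_degree_sum[of p q] by simp
next
  case False
  then have "degree p + degree q < m + n" using assms by linarith
  then have "degree (p * q) < m + n" using degree_mult_le le_less_trans by blast
  then show ?thesis using False assms by (auto simp: coeff_eq_0)
qed

text \<open>Horner recursion on \<open>f\<close>. A degree bound and the coefficient at that bound
  are tracked together, so that a vanishing \<open>coeff g A\<close> needs no separate case.\<close>

lemma coeff_pcompose_le_degree:
  fixes f g :: "'a::idom poly"
  assumes "degree g \<le> A" "A > 0"
  shows "degree (pcompose f g) \<le> degree f * A \<and>
         coeff (pcompose f g) (degree f * A) = lead_coeff f * coeff g A ^ degree f"
proof (induction f)
  case 0
  show ?case by simp
next
  case (pCons a p)
  show ?case
  proof (cases "p = 0")
    case True
    then show ?thesis by (simp add: pcompose_pCons)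
  next
    case False
    define k where "k = A + degree p * A"
    have deg: "degree (pCons a p) * A = k" and "k > 0"
      using False assms(2) by (simp_all add: k_def)
    have "degree (g * pcompose p g) \<le> k"
      using degree_mult_le[of g "pcompose p g"] assms(1) pCons.IH unfolding k_def by linarith
    moreover have "coeff (g * pcompose p g) k = lead_coeff (pCons a p) * coeff g A ^ degree (pCons a p)"
      unfolding k_def using coeff_mult_le_degree[OF assms(1), of "pcompose p g" "degree p * A"] pCons.IH False
      by (simp add: mult_ac)
    moreover have "coeff [:a:] k = 0" using \<open>k > 0\<close> by (simp add: coeff_eq_0)
    ultimately show ?thesis
      unfolding deg pcompose_pCons coeff_add by (auto intro: degree_add_le)
  qed
qed

text \<open>To first order, \<open>f(g + h) - f(g)\<close> is \<open>f'(g) h\<close>, with leading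
  term \<open>d c g^(d-1) h\<close> for \<open>f\<close> of degree \<open>d\<close> and leading
  coefficient \<open>c\<close>. Since \<open>j < A\<close>, the terms of higher order in
  \<open>h\<close> have smaller degree.\<close>

lemma pcompose_perturbation:
  fixes f g h :: "'a::idom poly"
  assumes "degree g \<le> A" "degree h \<le> j" "j < A"
  shows "degree (pcompose f (g + h) - pcompose f g) \<le> (degree f - 1) * A + j \<and>
         coeff (pcompose f (g + h) - pcompose f g) ((degree f - 1) * A + j) =
           of_nat (degree f) * lead_coeff f * coeff g A ^ (degree f - 1) * coeff h j"
proof (induction f)
  case 0
  show ?case by (simp only: pcompose_0 diff_self degree_0 coeff_0 of_nat_0 mult_zero_left) simp
next
  case (pCons a p)
  show ?case
  proof (cases "p = 0")
    case True
    then show ?thesis by (simp add: pcompose_pCons)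
  next
    case False
    define D where "D = pcompose p (g + h) - pcompose p g"
    have eq: "pcompose (pCons a p) (g + h) - pcompose (pCons a p) g = (g + h) * D + h * pcompose p g"
      by (simp add: pcompose_pCons D_def algebra_simps)
    have gh: "degree (g + h) \<le> A" "coeff (g + h) A = coeff g A"
      using assms by (auto intro: degree_add_le simp: coeff_eq_0)
    note top = coeff_pcompose_le_degree[OF assms(1), of p, OF le_less_trans[OF le0 assms(3)]]
    have 1: "degree ((g + h) * D) \<le> degree p * A + j \<and>
      coeff ((g + h) * D) (degree p * A + j) =
        coeff g A * (of_nat (degree p) * lead_coeff p * coeff g A ^ (degree p - 1) * coeff h j)"
    proof (cases "degree p = 0")
      case True
      then obtain t where "p = [:t:]" by (rule degree_eq_zeroE)
      then show ?thesis by (simp add: D_def)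
    next
      case deg: False
      then have k: "degree p * A + j = A + ((degree p - 1) * A + j)" by (cases "degree p") auto
      show ?thesis unfolding k
        using coeff_mult_le_degree[OF gh(1), of D "(degree p - 1) * A + j"] pCons.IH gh
          degree_mult_le[of "g + h" D]
        unfolding D_def[symmetric] by auto
    qed
    have 2: "degree (h * pcompose p g) \<le> degree p * A + j \<and>
      coeff (h * pcompose p g) (degree p * A + j) = coeff h j * (lead_coeff p * coeff g A ^ degree p)"
      using coeff_mult_le_degree[OF assms(2), of "pcompose p g" "degree p * A"] top assms(2)
        degree_mult_le[of h "pcompose p g"] by (auto simp: add.commute)
    have dp: "degree (pCons a p) = Suc (degree p)"
      using False by simp_all
    have deg_sum: "degree ((g + h) * D + h * pcompose p g) \<le> degree p * A + j"
      using 1 2 by (intro degree_add_le) auto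
    define k where "k = degree p * A + j"
    have coeff_sum: "coeff ((g + h) * D + h * pcompose p g) k =
        coeff g A * (of_nat (degree p) * lead_coeff p * coeff g A ^ (degree p - 1) * coeff h j)
        + coeff h j * (lead_coeff p * coeff g A ^ degree p)"
      unfolding coeff_add k_def using 1 2 by (simp only:)
    also have "\<dots> = of_nat (Suc (degree p)) * lead_coeff p * coeff g A ^ degree p * coeff h j"
      by (cases "degree p") (simp_all add: algebra_simps)
    finally have "coeff ((g + h) * D + h * pcompose p g) k =
      of_nat (Suc (degree p)) * lead_coeff p * coeff g A ^ degree p * coeff h j" .
    then show ?thesis
      unfolding eq dp diff_Suc_1 coeff_pCons_Suc k_def[symmetric] using deg_sum[folded k_def] by blast
  qed
qed

lemma degree_less_if_coeff_eq_0:
  assumes "degree p \<le> n" "coeff p n = 0" "n > 0"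
  shows "degree p < n"
proof -
  have "degree p \<noteq> n" using assms(2,3) leading_coeff_0_iff[of p] by auto
  then show ?thesis using assms(1) by simp
qed

text \<open>The polynomial part at infinity of \<open>f\<^sup>-\<^sup>1 \<circ> P\<close>, computed one coefficient at a time.\<close>

lemma ex_polynomial_root_approx:
  fixes f P :: "real poly"
  assumes "degree f \<ge> 2" "A > 0" "r > 0"
    and P: "degree P \<le> degree f * A" "coeff P (degree f * A) = lead_coeff f * r ^ degree f"
    and "j \<le> A"
  shows "\<exists>g. degree g = A \<and> lead_coeff g = r \<and> degree (pcompose f g - P) < (degree f - 1) * A + j"
proof -
  have f0: "lead_coeff f \<noteq> 0" using assms(1) by auto
  have "\<exists>g. degree g = A \<and> lead_coeff g = r \<and> degree (pcompose f g - P) < (degree f - 1) * A + (A - i)"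
    if "i \<le> A" for i using that
  proof (induction i)
    case 0
    let ?g = "monom r A"
    have g: "degree ?g = A" "lead_coeff ?g = r" using assms(3) by (auto simp: degree_monom_eq)
    have k: "(degree f - 1) * A + (A - 0) = degree f * A" using assms(1) by (cases "degree f") auto
    have "degree (pcompose f ?g - P) < degree f * A"
      using coeff_pcompose_le_degree[of ?g A f] P assms(1,2) g
      by (intro degree_less_if_coeff_eq_0 degree_diff_le) auto
    then show ?case using g unfolding k by blast
  next
    case (Suc i)
    define j where "j = A - Suc i"
    have j: "A - i = Suc j" "j < A" using Suc.prems by (auto simp: j_def)
    obtain g where g: "degree g = A" "lead_coeff g = r" "degree (pcompose f g - P) < (degree f - 1) * A + Suc j"
      using Suc j by auto
    define k where "k = (degree f - 1) * A + j"
    have "k > 0" using assms(1,2) by (simp add: k_def)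
    \<comment> \<open>By \<open>pcompose_perturbation\<close>, adding \<open>t y^j\<close> to
      \<open>g\<close> changes the coefficient at \<open>k\<close> by \<open>d c r^(d-1) t\<close>;
      this \<open>t\<close> makes it vanish, and the coefficients above \<open>k\<close> stay
      zero.\<close>
    define t where "t = - coeff (pcompose f g - P) k / (of_nat (degree f) * lead_coeff f * r ^ (degree f - 1))"
    let ?g = "g + monom t j"
    have deg: "degree (monom t j) \<le> j" by (rule degree_monom_le)
    note pert = pcompose_perturbation[OF eq_refl[OF g(1)] deg j(2), of f, folded k_def]
    have eq: "pcompose f ?g - P = (pcompose f ?g - pcompose f g) + (pcompose f g - P)" by simp
    have "degree (pcompose f ?g - P) < k"
    proof (intro degree_less_if_coeff_eq_0)
      show "degree (pcompose f ?g - P) \<le> k"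
        unfolding eq using pert g(3) k_def by (intro degree_add_le) auto
      have "coeff (pcompose f ?g - P) k = of_nat (degree f) * lead_coeff f * r ^ (degree f - 1) * t + coeff (pcompose f g - P) k"
        unfolding eq coeff_add using pert g by simp
      also have "\<dots> = 0" using f0 assms(1,3) by (auto simp: t_def)
      finally show "coeff (pcompose f ?g - P) k = 0" .
    qed fact
    moreover have "degree ?g = A" using g(1) j(2) deg by (simp add: degree_add_eq_left)
    moreover have "coeff ?g A = r" using g j(2) by (simp add: coeff_eq_0 degree_monom_eq)
    ultimately have "degree ?g = A \<and> lead_coeff ?g = r \<and> degree (pcompose f ?g - P) < (degree f - 1) * A + (A - Suc i)"
      by (simp add: k_def j_def)
    then show ?case by blast
  qed
  from this[of "A - j"] assms(6) show ?thesis by simp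
qed

section \<open>Growth of real polynomials\<close>

lemma poly_eventually_pos:
  fixes p :: "real poly"
  assumes "lead_coeff p > 0"
  shows "\<exists>X. \<forall>x\<ge>X. poly p x > 0"
  using poly_pinfty_gt_lc[OF assms] assms by (meson less_le_trans)

lemma poly_eventually_gt:
  fixes p :: "real poly"
  assumes "lead_coeff p > 0" "degree p > 0"
  shows "\<exists>X. \<forall>x\<ge>X. poly p x > B"
proof -
  have "degree (p - [:B:]) = degree p"
    unfolding diff_conv_add_uminus by (rule degree_add_eq_left) (use assms(2) in simp)
  moreover have "coeff (p - [:B:]) (degree p) = lead_coeff p"
    using assms(2) by (simp add: coeff_eq_0)
  ultimately show ?thesis using poly_eventually_pos[of "p - [:B:]"] assms(1) by auto
qed

text \<open>Only \<open>y\<close> has to be large: on the interval \<open>[0, X1]\<close> the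
  polynomial is bounded, and it exceeds this bound for large \<open>y\<close>. Hence an equation
  \<open>f(n) = f(t)\<close> with \<open>t\<close> large determines \<open>n\<close> even if
  \<open>n\<close> is not known to be large.\<close>

lemma poly_eventually_increasing:
  fixes f :: "real poly"
  assumes "lead_coeff f > 0" "degree f > 0"
  shows "\<exists>X\<ge>0. \<forall>x y. 0 \<le> x \<longrightarrow> x < y \<longrightarrow> X \<le> y \<longrightarrow> poly f x < poly f y"
proof -
  have "lead_coeff (pderiv f) > 0"
    using assms by (simp add: degree_pderiv coeff_pderiv)
  then obtain X0 where X0: "\<And>x. x \<ge> X0 \<Longrightarrow> poly (pderiv f) x > 0" using poly_eventually_pos by blast
  define X1 where "X1 = max 0 X0"
  have mono: "poly f x < poly f y" if "X1 \<le> x" "x < y" for x y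
    
  proof (rule DERIV_pos_imp_increasing[OF that(2)])
    fix t assume "x \<le> t" "t \<le> y"
    then have "poly (pderiv f) t > 0" using that X0 by (simp add: X1_def)
    then show "\<exists>D. (poly f has_real_derivative D) (at t) \<and> D > 0" using poly_DERIV by blast
  qed
  obtain M where M: "\<And>x. 0 \<le> x \<Longrightarrow> x \<le> X1 \<Longrightarrow> poly f x \<le> M"
    using isCont_eq_Ub[of 0 X1 "poly f"] by (auto simp: X1_def)
  obtain X2 where X2: "\<And>x. x \<ge> X2 \<Longrightarrow> poly f x > M" using poly_eventually_gt[OF assms] by blast
  show ?thesis
  proof (intro exI[of _ "max X1 X2"] conjI allI impI)
    fix x y :: real assume xy: "0 \<le> x" "x < y" "max X1 X2 \<le> y"
    show "poly f x < poly f y"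
    proof (cases "x \<le> X1")
      case True
      then show ?thesis using M[OF xy(1)] X2[of y] xy(3) by force
    qed (use mono xy in auto)
  qed (simp add: X1_def)
qed

section \<open>Integer sequences asymptotic to polynomials in \<open>q^i\<close>\<close>

lemma filterlim_real_power_at_top:
  assumes "(q::nat) \<ge> 2"
  shows "filterlim (\<lambda>i. real q ^ i) at_top sequentially"
proof (rule filterlim_at_top_mono[OF filterlim_real_sequentially])
  have "i \<le> q ^ i" for i
    using less_exp[of i] power_mono[OF assms, of i] by linarith
  then have "real i \<le> real q ^ i" for i
    by (metis of_nat_le_iff of_nat_power)
  then show "eventually (\<lambda>i. real i \<le> real q ^ i) sequentially" by simp
qed

lemma poly_zero_if_tendsto_0:
  fixes p :: "real poly" and q :: nat
  assumes "(\<lambda>i. poly p (real q ^ i)) \<longlonglongrightarrow> 0" "q \<ge> 2"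
  shows "p = 0"
proof (rule ccontr)
  assume "p \<noteq> 0"
  have pos: False if p: "lead_coeff p > 0" "(\<lambda>i. poly p (real q ^ i)) \<longlonglongrightarrow> 0" for p
  proof -
    obtain X where X: "\<And>x. x \<ge> X \<Longrightarrow> poly p x \<ge> lead_coeff p" using poly_pinfty_gt_lc[OF p(1)] by blast
    have "eventually (\<lambda>i. real q ^ i \<ge> X) sequentially"
      using filterlim_real_power_at_top[OF assms(2)] by (auto simp: filterlim_at_top)
    then have "eventually (\<lambda>i. lead_coeff p \<le> poly p (real q ^ i)) sequentially"
      by eventually_elim (rule X)
    then have "lead_coeff p \<le> 0" using p(2) by (intro tendsto_lowerbound) auto
    then show False using p(1) by simp
  qed
  from \<open>p \<noteq> 0\<close> have "lead_coeff p > 0 \<or> lead_coeff (- p) > 0"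
    by (metis leading_coeff_0_iff degree_minus coeff_minus linorder_neqE_linordered_idom neg_0_less_iff_less)
  then show False using pos[of p] pos[of "- p"] assms(1) tendsto_minus[OF assms(1)] by auto
qed

text \<open>An open interval of length 1 contains at most one integer, so the sequence is eventually
  constant, which makes the real number \<open>c\<close> an integer.\<close>

lemma int_sequence_eventually_0:
  fixes n :: "nat \<Rightarrow> int"
  assumes "(\<lambda>i. real_of_int (n i) - c) \<longlonglongrightarrow> 0"
  shows "eventually (\<lambda>i. real_of_int (n i) = c) sequentially"
proof -
  have lim: "(\<lambda>i. real_of_int (n i)) \<longlonglongrightarrow> c" using assms by (simp add: LIM_zero_iff)
  have "eventually (\<lambda>i. \<bar>real_of_int (n i) - c\<bar> < 1/2) sequentially"
    using tendstoD[OF lim, of "1/2"] by (simp add: dist_real_def)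
  then obtain N where N: "\<And>i. i \<ge> N \<Longrightarrow> \<bar>real_of_int (n i) - c\<bar> < 1/2"
    by (auto simp: eventually_sequentially)
  have "n i = n N" if "i \<ge> N" for i
    using N[OF that] N[of N] by linarith
  then have "eventually (\<lambda>i. real_of_int (n i) = real_of_int (n N)) sequentially"
    by (intro eventually_sequentiallyI[of N] arg_cong[of _ _ real_of_int])
  then have "(\<lambda>i. real_of_int (n i)) \<longlonglongrightarrow> real_of_int (n N)"
    by (rule tendsto_eventually)
  then have "c = real_of_int (n N)" using lim LIMSEQ_unique by blast
  then show ?thesis using \<open>eventually (\<lambda>i. real_of_int (n i) = real_of_int (n N)) sequentially\<close> by simp
qed

text \<open>Induction on the degree, for integers because differences may be negative. Once the
  reduced sequence is exact, the error satisfies \<open>\<delta> (Suc i) = q^A \<delta> i\<close>;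
  it cannot decrease in absolute value and tends to 0, hence it vanishes.\<close>

lemma int_sequence_eventually_eq_poly:
  fixes n :: "nat \<Rightarrow> int" and g :: "real poly" and q :: nat
  assumes "(\<lambda>i. real_of_int (n i) - poly g (real q ^ i)) \<longlonglongrightarrow> 0" "q \<ge> 2"
  shows "eventually (\<lambda>i. real_of_int (n i) = poly g (real q ^ i)) sequentially"
  using assms(1)
proof (induction "degree g" arbitrary: g n rule: less_induct)
  case less
  show ?case
  proof (cases "degree g = 0")
    case True
    then obtain t where "g = [:t:]" by (rule degree_eq_zeroE)
    then show ?thesis using int_sequence_eventually_0[of n t] less.prems by simp
  next
    case False
    define A where "A = degree g"
    \<comment> \<open>The operator \<open>n(i) \<mapsto> n(i+1) - q\<^sup>A n(i)\<close> preserves integrality and annihilates the leading term.\<close>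
    define g' where "g' = pcompose g [:0, real q:] - smult (real q ^ A) g"
    define m where "m i = n (Suc i) - int q ^ A * n i" for i
    define \<delta> where "\<delta> i = real_of_int (n i) - poly g (real q ^ i)" for i
    have \<delta>: "\<delta> \<longlonglongrightarrow> 0" using less.prems by (simp add: \<delta>_def[abs_def])
    have "degree g' < A"
      unfolding g'_def using False
      by (intro degree_less_if_coeff_eq_0 degree_diff_le) (auto simp: A_def degree_pcompose degree_smult_le coeff_pcompose_linear)
    moreover have step: "real_of_int (m i) - poly g' (real q ^ i) = \<delta> (Suc i) - real q ^ A * \<delta> i" for i
      by (simp add: m_def g'_def \<delta>_def poly_pcompose algebra_simps)
    moreover have "(\<lambda>i. \<delta> (Suc i) - real q ^ A * \<delta> i) \<longlonglongrightarrow> 0 - real q ^ A * 0"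
      by (intro tendsto_intros \<delta> LIMSEQ_Suc)
    ultimately have "eventually (\<lambda>i. real_of_int (m i) = poly g' (real q ^ i)) sequentially"
      using less.hyps[of g' m] by (simp add: A_def)
    then have "eventually (\<lambda>i. real_of_int (m i) - poly g' (real q ^ i) = 0) sequentially"
      by simp
    then obtain N where N: "\<And>i. i \<ge> N \<Longrightarrow> \<delta> (Suc i) = real q ^ A * \<delta> i"
      unfolding step eventually_sequentially by auto
    have "\<delta> i = 0" if "i \<ge> N" for i
    proof -
      have "\<bar>\<delta> i\<bar> \<le> \<bar>\<delta> j\<bar>" if "j \<ge> i" for j
        using that
      proof (induction j rule: dec_induct)
        case (step j)
        have "1 * \<bar>\<delta> j\<bar> \<le> real q ^ A * \<bar>\<delta> j\<bar>"
          using \<open>q \<ge> 2\<close> by (intro mult_right_mono one_le_power) auto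
        then show ?case using step N[of j] \<open>i \<ge> N\<close> by (simp add: abs_mult)
      qed simp
      then have "eventually (\<lambda>j. \<bar>\<delta> i\<bar> \<le> \<bar>\<delta> j\<bar>) sequentially"
        by (auto simp: eventually_sequentially)
      then have "\<bar>\<delta> i\<bar> \<le> 0"
        using tendsto_rabs_zero[OF \<delta>] by (intro tendsto_lowerbound) auto
      then show ?thesis by simp
    qed
    then show ?thesis by (auto simp: \<delta>_def eventually_sequentially)
  qed
qed

section \<open>Compositions with three terms\<close>

lemma ex_monom_decomp:
  fixes p :: "'a::idom poly"
  assumes "p \<noteq> 0"
  shows "\<exists>k u. p = monom 1 k * u \<and> coeff u 0 \<noteq> 0"
  using assms
proof (induction p)
  case (pCons a p)
  show ?case
  proof (cases "a = 0")
    case True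
    then obtain k u where "p = monom 1 k * u" "coeff u 0 \<noteq> 0" using pCons by auto
    then have "pCons a p = monom 1 (Suc k) * u" using True by (simp add: monom_Suc)
    then show ?thesis using \<open>coeff u 0 \<noteq> 0\<close> by blast
  next
    case False
    then show ?thesis by (intro exI[of _ 0] exI[of _ "pCons a p"]) (auto simp: one_pCons monom_0)
  qed
qed simp

text \<open>A nonzero constant coefficient means that \<open>y\<close> does not divide the factor,
  so both sides contain the same power of \<open>y\<close>.\<close>

lemma monom_mult_cancel:
  fixes u w :: "'a::idom poly"
  assumes "monom 1 i * u = monom 1 j * w" "coeff u 0 \<noteq> 0" "coeff w 0 \<noteq> 0"
  shows "u = w"
proof -
  have less: "j \<le> i" if eq: "monom 1 i * u = monom 1 j * w" "coeff u 0 \<noteq> 0" for i j and u w :: "'a poly"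
  proof (rule ccontr)
    assume "\<not> j \<le> i"
    then have "coeff (monom 1 j * w) i = 0" by (simp add: coeff_monom_mult)
    moreover have "coeff (monom 1 i * u) i = coeff u 0" by (simp add: coeff_monom_mult)
    ultimately show False using eq by simp
  qed
  have "i = j" using less[OF assms(1,2)] less[OF assms(1)[symmetric] assms(3)] by simp
  then show ?thesis using assms(1) by simp
qed

lemma coeff_pcompose_monom:
  fixes p :: "'a::idom poly"
  assumes "A > 0"
  shows "coeff (pcompose p (monom r A)) n = (if A dvd n then coeff p (n div A) * r ^ (n div A) else 0)"
proof (induction p arbitrary: n)
  case 0
  show ?case by simp
next
  case (pCons a p)
  have eq: "coeff (pcompose (pCons a p) (monom r A)) n =
      coeff [:a:] n + (if n < A then 0 else r * coeff (pcompose p (monom r A)) (n - A))"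
    by (simp add: pcompose_pCons coeff_monom_mult)
  show ?case
  proof (cases "n < A")
    case True
    then show ?thesis unfolding eq using assms
      by (cases "n = 0") (auto simp: coeff_pCons dvd_imp_le nat_dvd_not_less split: nat.splits)
  next
    case False
    then have n: "n div A = Suc ((n - A) div A)" "A dvd n \<longleftrightarrow> A dvd (n - A)" "n > 0"
      using assms by (auto simp: le_div_geq dvd_minus_self)
    then show ?thesis unfolding eq pCons.IH using False
      by (auto simp: coeff_pCons mult_ac split: nat.splits)
  qed
qed

lemma monom_1_add: "monom (1 :: 'a::comm_semiring_1) (i + j) = monom 1 i * monom 1 j"
  by (simp add: mult_monom)

lemma degree_monom_1_mult:
  fixes u :: "'a::idom poly"
  assumes "u \<noteq> 0"
  shows "degree (monom 1 k * u) = k + degree u"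
  using assms by (simp add: degree_mult_eq degree_monom_eq)

text \<open>If \<open>g\<close> had a third term, then \<open>(f' \<circ> g) g'\<close>, a binomial up to a power of \<open>y\<close>, would force
  \<open>f' \<circ> g\<close> to be a monomial; differentiating once more, \<open>g'\<close> would be a monomial.\<close>

lemma pcompose_eq_trinomial:
  fixes f g :: "real poly"
  defines "d \<equiv> degree f" and "c \<equiv> lead_coeff f"
  defines "\<sigma> \<equiv> coeff f (d - 1) / (d * c)"
  assumes d: "d \<ge> 2" and g: "degree g = A" "lead_coeff g = r" "A > 0" "r > 0"
    and comp: "pcompose f g = monom \<alpha> (d * A) + monom \<beta> b + [:\<gamma>:]" and "b < d * A"
  shows "\<exists>s. g = monom r A + [:s:] \<and>
           (s = - \<sigma> \<or> b = (d - 1) * A \<and> \<beta> = d * c * r ^ (d - 1) * (s + \<sigma>))"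
proof -
  have "c \<noteq> 0" using d by (auto simp: c_def d_def)
  \<comment> \<open>The candidate for \<open>g\<close> with \<open>s = - \<sigma>\<close>;
    \<open>h\<close> measures the deviation from it.\<close>
  define g0 where "g0 = monom r A + [:-\<sigma>:]"
  define h where "h = g - g0"
  have coeff_g0: "coeff g0 A = r" "degree g0 \<le> A"
    using g(3) by (auto simp: g0_def coeff_eq_0 degree_monom_le intro!: degree_add_le)
  have "degree h < A"
    unfolding h_def using g coeff_g0 by (intro degree_less_if_coeff_eq_0 degree_diff_le) auto
  have "g0 + h = g" by (simp add: h_def)
  have g_eq: "g = monom r A + [:-\<sigma>:] + h" by (simp add: h_def g0_def)
  show ?thesis
  proof (cases "h = 0")
    case True
    then show ?thesis using g_eq by auto
  next
    case False
    define j where "j = degree h"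
    define N where "N = (d - 1) * A + j"
    have "d * A = (d - 1) * A + A" using d by (cases d) auto
    then have N: "N < d * A" "N > 0" using \<open>degree h < A\<close> d g(3) by (auto simp: N_def j_def)
    have 1: "coeff (pcompose f g - pcompose f g0) N = d * c * r ^ (d - 1) * coeff h j"
      using pcompose_perturbation[OF coeff_g0(2) order_refl \<open>degree h < A\<close>, of f]
      by (simp add: j_def N_def d_def c_def coeff_g0 \<open>g0 + h = g\<close>)
    \<comment> \<open>Shifting the variable by \<open>- \<sigma>\<close> removes the coefficient of
      degree \<open>d - 1\<close>, so that \<open>f \<circ> g0\<close>, which is
      \<open>F(r y^A)\<close>, has no term of degree \<open>N\<close>.\<close>
    define F where "F = pcompose f [:-\<sigma>, 1:]"
    have "coeff (F - f) (d - 1) = d * c * (- \<sigma>)"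
      using pcompose_perturbation[of "[:0, 1:]" 1 "[:-\<sigma>:]" 0 f] by (simp add: F_def d_def c_def)
    then have F0: "coeff F (d - 1) = 0" using d \<open>c \<noteq> 0\<close> by (simp add: \<sigma>_def)
    have "pcompose f g0 = pcompose F (monom r A)"
      unfolding F_def pcompose_assoc[symmetric] by (simp add: pcompose_pCons g0_def add.commute)
    then have "coeff (pcompose f g0) N = 0"
    proof (cases "j = 0")
      case False
      then have "\<not> A dvd N" using \<open>degree h < A\<close>
        by (auto simp: N_def j_def dvd_add_right_iff nat_dvd_not_less)
      then show ?thesis using \<open>pcompose f g0 = pcompose F (monom r A)\<close> g(3) by (simp add: coeff_pcompose_monom)
    qed (use g(3) F0 in \<open>simp add: coeff_pcompose_monom N_def\<close>)
    then have top: "coeff (pcompose f g) N = d * c * r ^ (d - 1) * coeff h j" using 1 by simp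
    moreover have "d * c * r ^ (d - 1) * coeff h j \<noteq> 0"
      using False d \<open>c \<noteq> 0\<close> g(4) by (auto simp: j_def)
    \<comment> \<open>\<open>N\<close> lies strictly between 0 and \<open>d A\<close>, so a nonzero
      coefficient there can only come from the middle term.\<close>
    moreover have "coeff (pcompose f g) N = (if b = N then \<beta> else 0)"
      unfolding comp using N by (auto simp: coeff_eq_0)
    ultimately have b: "b = N" and \<beta>: "\<beta> = d * c * r ^ (d - 1) * coeff h j" "\<beta> \<noteq> 0"
      by (auto split: if_splits)
    have "j = 0"
    proof (rule ccontr)
      assume "j \<noteq> 0"
      have "A > j" using \<open>degree h < A\<close> by (simp add: j_def)
      \<comment> \<open>The derivative of the trinomial is \<open>y^(b-1) w\<close>.\<close>
      define w where "w = monom (\<alpha> * (d * A)) (A - j) + [:\<beta> * b:]"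
      have "d * A - 1 = (b - 1) + (A - j)"
        using \<open>d * A = (d - 1) * A + A\<close> \<open>A > j\<close> N(2) unfolding b N_def by linarith
      then have "pcompose (pderiv f) g * pderiv g = monom 1 (b - 1) * w"
        unfolding pderiv_pcompose[symmetric] comp w_def
        by (simp add: pderiv_add pderiv_monom pderiv_pCons distrib_left mult_monom mult.commute
              del: mult_pCons_right) (simp add: smult_monom)
      have w0: "coeff w 0 \<noteq> 0" using \<open>A > j\<close> \<beta>(2) N(2) b by (simp add: w_def)
      have degw: "degree w \<le> A - j" unfolding w_def by (intro degree_add_le degree_monom_le) auto
      have "pcompose (pderiv f) g \<noteq> 0" "pderiv g \<noteq> 0"
        using \<open>pcompose (pderiv f) g * pderiv g = monom 1 (b - 1) * w\<close> w0 by (auto simp: monom_eq_0_iff)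
      then obtain t u l v where u: "pderiv g = monom 1 t * u" "coeff u 0 \<noteq> 0"
        and v: "pcompose (pderiv f) g = monom 1 l * v" "coeff v 0 \<noteq> 0"
        using ex_monom_decomp by metis
      have [simp]: "u \<noteq> 0" "v \<noteq> 0" using u(2) v(2) by auto
      have "coeff g j = coeff h j" unfolding g_eq using \<open>A > j\<close> \<open>j \<noteq> 0\<close> by (simp add: coeff_eq_0)
      then have "coeff (pderiv g) (j - 1) \<noteq> 0"
        using \<open>j \<noteq> 0\<close> False by (simp add: coeff_pderiv j_def)
      \<comment> \<open>The term of degree \<open>j\<close> in \<open>g\<close> limits the power of
        \<open>y\<close> dividing \<open>g'\<close>. This leaves \<open>u\<close> of degree at least
        \<open>A - j\<close>, which is also the upper bound for the degree of
        \<open>w\<close>.\<close>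
      then have "t \<le> j - 1" unfolding u(1) coeff_monom_mult by (auto split: if_splits)
      moreover have "t + degree u = A - 1"
        using arg_cong[OF u(1), of degree] g(1) by (simp add: degree_monom_1_mult degree_pderiv)
      ultimately have degu: "degree u \<ge> A - j" using \<open>A > j\<close> \<open>j \<noteq> 0\<close> by linarith
      have "monom 1 (l + t) * (v * u) = monom 1 (b - 1) * w"
        using \<open>pcompose (pderiv f) g * pderiv g = monom 1 (b - 1) * w\<close>
        unfolding u(1) v(1) by (simp add: monom_1_add mult_ac)
      then have "v * u = w" by (rule monom_mult_cancel) (use u(2) v(2) w0 in \<open>simp_all add: coeff_mult_0\<close>)
      then have "degree v = 0" using degu degw by (auto simp: degree_mult_eq)
      then obtain \<kappa> where \<kappa>: "v = [:\<kappa>:]" by (rule degree_eq_zeroE)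
      \<comment> \<open>Now \<open>f' \<circ> g\<close> is a monomial. Its derivative is one too,
        and the same cancellation makes \<open>u\<close> constant, against
        \<open>degree u \<ge> A - j\<close>.\<close>
      have "pcompose (pderiv f) g = monom \<kappa> l" unfolding v(1) \<kappa> by (simp add: smult_monom)
      then have deriv2: "pcompose (pderiv (pderiv f)) g * pderiv g = monom (of_nat l * \<kappa>) (l - 1)"
        by (metis pderiv_pcompose pderiv_monom)
      have "degree (pderiv f) = d - 1" by (simp add: degree_pderiv d_def)
      then have "pderiv (pderiv f) \<noteq> 0" using d by (auto simp: pderiv_eq_0_iff)
      then have "pcompose (pderiv (pderiv f)) g \<noteq> 0" using pcompose_eq_0 g(1,3) by blast
      then obtain l' v' where v': "pcompose (pderiv (pderiv f)) g = monom 1 l' * v'" "coeff v' 0 \<noteq> 0"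
        using ex_monom_decomp by blast
      have [simp]: "v' \<noteq> 0" using v'(2) by auto
      have "monom 1 (l' + t) * (v' * u) = monom 1 (l - 1) * [:of_nat l * \<kappa>:]"
        using deriv2 unfolding v'(1) u(1)
        by (simp add: monom_1_add mult_ac smult_monom)
      then have "v' * u = [:of_nat l * \<kappa>:]"
      proof (rule monom_mult_cancel)
        show "coeff (v' * u) 0 \<noteq> 0" using u(2) v'(2) by (simp add: coeff_mult_0)
        have "pcompose (pderiv (pderiv f)) g * pderiv g \<noteq> 0"
          using \<open>pcompose (pderiv (pderiv f)) g \<noteq> 0\<close> \<open>pderiv g \<noteq> 0\<close> by simp
        then show "coeff [:of_nat l * \<kappa>:] 0 \<noteq> 0" unfolding deriv2 by (simp add: monom_eq_0_iff)
      qed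
      then have "degree (v' * u) = 0" by simp
      then have "degree u = 0" by (simp add: degree_mult_eq)
      then show False using degu \<open>A > j\<close> by simp
    qed
    then obtain s' where s': "h = [:s':]" using j_def degree_eq_zeroE by metis
    show ?thesis
      using g_eq b \<beta>(1) \<open>j = 0\<close> by (intro exI[of _ "s' - \<sigma>"]) (auto simp: s' N_def)
  qed
qed

text \<open>Comparing \<open>P\<close> with \<open>f \<circ> (g + \<epsilon>)\<close> and
  \<open>f \<circ> (g - \<epsilon>)\<close> and using that \<open>f\<close> increases,
  \<open>n i - g(q^i)\<close> tends to 0. Integrality makes this exact for large \<open>i\<close>,
  which forces \<open>f \<circ> g = P\<close> as polynomials and hence an identity for all
  \<open>i\<close>. It concerns values of \<open>f\<close>, since \<open>f\<close> may fail to be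
  injective at small arguments.\<close>

lemma polynomial_values_at_exponentials:
  fixes f :: "real poly" and n :: "nat \<Rightarrow> nat" and q :: nat
  defines "d \<equiv> degree f" and "c \<equiv> lead_coeff f"
  defines "\<sigma> \<equiv> coeff f (d - 1) / (d * c)"
  assumes d: "d \<ge> 2" and c: "c > 0" and q: "q \<ge> 2" and A: "A > 0" and b: "b < d * A" and \<alpha>: "\<alpha> > 0"
    and vals: "\<And>i. poly f (real (n i)) = \<alpha> * (real q ^ i) ^ (d * A) + \<beta> * (real q ^ i) ^ b + \<gamma>"
  shows "\<exists>r s. r > 0 \<and> c * r ^ d = \<alpha> \<and>
    (\<forall>i. poly f (r * (real q ^ i) ^ A + s) = poly f (real (n i))) \<and>
    (s = - \<sigma> \<or> b = (d - 1) * A \<and> \<beta> = d * c * r ^ (d - 1) * (s + \<sigma>))"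
proof -
  define P where "P = monom \<alpha> (d * A) + monom \<beta> b + [:\<gamma>:]"
  have P: "poly P (real q ^ i) = poly f (real (n i))" for i
    by (simp add: P_def vals poly_monom)
  have "d * A > 0" using d A by simp
  have degP: "degree P \<le> d * A" "coeff P (d * A) = \<alpha>"
    using b \<open>d * A > 0\<close> unfolding P_def
    by (auto intro!: degree_add_le degree_monom_le order_trans[OF degree_monom_le] simp: coeff_eq_0)
  define r where "r = root d (\<alpha> / c)"
  have r: "r > 0" "c * r ^ d = \<alpha>" using \<alpha> c d by (auto simp: r_def)
  obtain g where g: "degree g = A" "lead_coeff g = r" "degree (pcompose f g - P) < (d - 1) * A"
    using ex_polynomial_root_approx[of f A r P 0] d A r degP by (auto simp: d_def c_def)
  define k where "k = (d - 1) * A"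
  \<comment> \<open>Shifting \<open>g\<close> by \<open>\<epsilon>\<close> adds a term of degree
    \<open>k\<close>, which dominates the error \<open>f \<circ> g - P\<close> of degree below
    \<open>k\<close>.\<close>
  have near: "degree (pcompose f (g + [:\<epsilon>:]) - P) \<le> k \<and>
      coeff (pcompose f (g + [:\<epsilon>:]) - P) k = d * c * r ^ (d - 1) * \<epsilon>" for \<epsilon>
  proof -
    have eq: "pcompose f (g + [:\<epsilon>:]) - P = (pcompose f (g + [:\<epsilon>:]) - pcompose f g) + (pcompose f g - P)" by simp
    have pert: "degree (pcompose f (g + [:\<epsilon>:]) - pcompose f g) \<le> k \<and>
        coeff (pcompose f (g + [:\<epsilon>:]) - pcompose f g) k = d * c * r ^ (d - 1) * \<epsilon>"
      using pcompose_perturbation[of g A "[:\<epsilon>:]" 0 f] g A by (simp add: d_def c_def k_def)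
    have small: "degree (pcompose f g - P) \<le> k" "coeff (pcompose f g - P) k = 0"
      using g(3) by (simp_all only: k_def coeff_eq_0 less_imp_le)
    show ?thesis
      unfolding eq coeff_add[of _ "pcompose f g - P"] small(2) add_0_right
      using conjunct1[OF pert] conjunct2[OF pert] small(1) degree_add_le by blast
  qed
  have lead_near: "lead_coeff (pcompose f (g + [:\<epsilon>:]) - P) = d * c * r ^ (d - 1) * \<epsilon>" if "\<epsilon> \<noteq> 0" for \<epsilon>
  proof -
    have "d * c * r ^ (d - 1) * \<epsilon> \<noteq> 0" using that r c d by auto
    then have "degree (pcompose f (g + [:\<epsilon>:]) - P) = k"
      using near[of \<epsilon>] by (metis le_antisym le_degree)
    then show ?thesis using near[of \<epsilon>] by simp
  qed
  obtain X where X: "X \<ge> 0" "\<And>x y. 0 \<le> x \<Longrightarrow> x < y \<Longrightarrow> X \<le> y \<Longrightarrow> poly f x < poly f y"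
    using poly_eventually_increasing[of f] c d by (auto simp: c_def d_def)
  have "(\<lambda>i. real_of_int (int (n i)) - poly g (real q ^ i)) \<longlonglongrightarrow> 0"
  proof (rule LIMSEQ_I)
    fix \<epsilon> :: real assume "\<epsilon> > 0"
    have "lead_coeff (pcompose f (g + [:\<epsilon>:]) - P) > 0"
      unfolding lead_near[OF less_imp_neq[OF \<open>\<epsilon> > 0\<close>, symmetric]] using \<open>\<epsilon> > 0\<close> c r d by simp
    then obtain X1 where X1: "\<And>y. y \<ge> X1 \<Longrightarrow> poly (pcompose f (g + [:\<epsilon>:]) - P) y > 0"
      using poly_eventually_pos by blast
    have "lead_coeff (- (pcompose f (g + [:-\<epsilon>:]) - P)) > 0"
      unfolding degree_minus coeff_minus using lead_near[of "-\<epsilon>"] \<open>\<epsilon> > 0\<close> c r d by simp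
    then obtain X2 where X2: "\<And>y. y \<ge> X2 \<Longrightarrow> poly (- (pcompose f (g + [:-\<epsilon>:]) - P)) y > 0"
      using poly_eventually_pos by blast
    \<comment> \<open>The margin keeps \<open>g - \<epsilon>\<close> above \<open>X\<close>, as the
      comparison with \<open>n i\<close> requires.\<close>
    obtain X3 where X3: "\<And>y. y \<ge> X3 \<Longrightarrow> poly g y > X + \<epsilon>"
      using poly_eventually_gt[of g] g r A by auto
    have close: "norm (real_of_int (int (n i)) - poly g (real q ^ i) - 0) < \<epsilon>"
      if "real q ^ i \<ge> max X1 (max X2 X3)" for i
    proof -
      let ?y = "real q ^ i"
      have up: "poly f (real (n i)) < poly f (poly g ?y + \<epsilon>)"
        using X1[of ?y] that by (simp add: poly_pcompose P)
      have low: "poly f (poly g ?y - \<epsilon>) < poly f (real (n i))"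
        using X2[of ?y] that by (simp add: poly_pcompose P)
      have big: "poly g ?y > X + \<epsilon>" using X3[of ?y] that by simp
      have "real (n i) < poly g ?y + \<epsilon>"
      proof (rule ccontr)
        assume "\<not> real (n i) < poly g ?y + \<epsilon>"
        then show False using X(2)[of "poly g ?y + \<epsilon>" "real (n i)"] up big \<open>\<epsilon> > 0\<close> X(1)
          by (cases "real (n i) = poly g ?y + \<epsilon>") auto
      qed
      moreover have "poly g ?y - \<epsilon> < real (n i)"
      proof (rule ccontr)
        assume "\<not> poly g ?y - \<epsilon> < real (n i)"
        then show False using X(2)[of "real (n i)" "poly g ?y - \<epsilon>"] low big \<open>\<epsilon> > 0\<close> X(1)
          by (cases "real (n i) = poly g ?y - \<epsilon>") auto
      qed
      ultimately show ?thesis by (simp add: abs_less_iff)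
    qed
    have "eventually (\<lambda>i. real q ^ i \<ge> max X1 (max X2 X3)) sequentially"
      using filterlim_real_power_at_top[OF q] unfolding filterlim_at_top by blast
    then show "\<exists>no. \<forall>i\<ge>no. norm (real_of_int (int (n i)) - poly g (real q ^ i) - 0) < \<epsilon>"
      using close unfolding eventually_sequentially by blast
  qed
  then have "eventually (\<lambda>i. real_of_int (int (n i)) = poly g (real q ^ i)) sequentially"
    by (rule int_sequence_eventually_eq_poly[where n = "\<lambda>i. int (n i)", OF _ q])
  then have "eventually (\<lambda>i. poly (pcompose f g - P) (real q ^ i) = 0) sequentially"
    by eventually_elim (simp add: poly_pcompose P)
  then have "pcompose f g - P = 0"
    using poly_zero_if_tendsto_0[OF tendsto_eventually q] by blast
  then have comp: "pcompose f g = monom \<alpha> (d * A) + monom \<beta> b + [:\<gamma>:]" by (simp add: P_def)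
  obtain s where s: "g = monom r A + [:s:]"
      "s = - \<sigma> \<or> b = (d - 1) * A \<and> \<beta> = d * c * r ^ (d - 1) * (s + \<sigma>)"
    using pcompose_eq_trinomial[of f g A r \<alpha> \<beta> b \<gamma>] d g(1,2) A r(1) comp b
    unfolding d_def c_def \<sigma>_def by blast
  have "poly f (r * (real q ^ i) ^ A + s) = poly f (real (n i))" for i
  proof -
    have "poly (pcompose f g) (real q ^ i) = poly f (real (n i))"
      using \<open>pcompose f g - P = 0\<close> P[of i] by simp
    then show ?thesis by (simp add: poly_pcompose s(1) poly_monom)
  qed
  then show ?thesis using r s(2) by blast
qed

subsection \<open>Values of pumped words\<close>

text \<open>Defined for arbitrary digit strings, because the pieces of a decomposed representation
  may begin with zeros.\<close>

definition word_value :: "nat \<Rightarrow> nat list \<Rightarrow> nat" where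
  "word_value q w = horner_sum (\<lambda>d. d) q (rev w)"

lemma word_value_Nil [simp]: "word_value q [] = 0"
  by (simp add: word_value_def)

lemma word_value_append: "word_value q (u @ v) = word_value q u * q ^ length v + word_value q v"
  by (simp add: word_value_def horner_sum_append mult.commute)

lemma word_value_base_rep: "word_value q (base_rep q n) = n"
  by (simp add: word_value_def horner_sum_base_rep)

lemma word_value_less: "set w \<subseteq> {..<q} \<Longrightarrow> word_value q w < q ^ length w"
proof (induction w rule: rev_induct)
  case (snoc d w)
  then have "word_value q w + 1 \<le> q ^ length w" "d < q" by auto
  then have "(word_value q w + 1) * q \<le> q ^ length w * q" by (intro mult_right_mono) auto
  moreover have "word_value q (w @ [d]) = word_value q w * q + d"
    by (simp add: word_value_append) (simp add: word_value_def)
  ultimately show ?case using \<open>d < q\<close> by (simp add: algebra_simps)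
qed simp

lemma real_word_value_le:
  assumes "set w \<subseteq> {..<q}"
  shows "real (word_value q w) + 1 \<le> real q ^ length w"
proof -
  have "real (word_value q w + 1) \<le> real (q ^ length w)"
    using word_value_less[OF assms] by (intro of_nat_mono) simp
  then show ?thesis by simp
qed

lemma word_value_ge:
  assumes "w \<noteq> []" "hd w \<noteq> 0"
  shows "q ^ (length w - 1) \<le> word_value q w"
proof -
  obtain d w' where w: "w = [d] @ w'" using assms(1) by (cases w) auto
  have "q ^ length w' \<le> d * q ^ length w'" using assms(2) w by simp
  moreover have "word_value q ([d] @ w') = d * q ^ length w' + word_value q w'"
    by (simp only: word_value_append) (simp add: word_value_def)
  ultimately have "q ^ length w' \<le> word_value q ([d] @ w')" by linarith
  then show ?thesis unfolding w by simp
qed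

lemma length_concat_replicate: "length (concat (replicate i v)) = length v * i"
  by (induction i) auto

lemma word_value_concat_replicate:
  assumes "v = [] \<or> q \<ge> 2"
  shows "real (word_value q (concat (replicate i v))) =
    real (word_value q v) / (real q ^ length v - 1) * ((real q ^ length v) ^ i - 1)"
proof (cases "v = []")
  case True
  have "concat (replicate i []) = []" for i by (induction i) auto
  then show ?thesis using True by simp
next
  case False
  define Q where "Q = real q ^ length v"
  have "Q > 1" unfolding Q_def using False assms by (intro one_less_power) auto
  have "real (word_value q (concat (replicate i v))) * (Q - 1) = real (word_value q v) * (Q ^ i - 1)"
  proof (induction i)
    case (Suc i)
    have "real (word_value q (concat (replicate (Suc i) v))) =
        real (word_value q v) * Q ^ i + real (word_value q (concat (replicate i v)))"
      by (simp add: word_value_append length_concat_replicate Q_def power_mult)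
    then show ?case using Suc by (simp add: algebra_simps)
  qed simp
  then show ?thesis using \<open>Q > 1\<close> unfolding Q_def[symmetric] by (simp add: field_simps)
qed

text \<open>For \<open>y = []\<close> the quotient \<open>real (word_value q y) / (real q ^ length y - 1)\<close> is
  \<open>0 / 0 = 0\<close>, and the formula below remains correct.\<close>

lemma word_value_pumped:
  fixes u v x y z :: "nat list" and q :: nat
  defines "V \<equiv> real (word_value q v) / (real q ^ length v - 1)"
    and "Y \<equiv> real (word_value q y) / (real q ^ length y - 1)"
  assumes "q \<ge> 2"
  shows "real (word_value q (u @ concat (replicate i v) @ x @ concat (replicate i y) @ z)) =
    real q ^ (length x + length z) * (real (word_value q u) + V) * (real q ^ i) ^ (length v + length y)
    + real q ^ length z * (real (word_value q x) + Y - real q ^ length x * V) * (real q ^ i) ^ length y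
    + (real (word_value q z) - real q ^ length z * Y)"
proof -
  have i: "(real q ^ i) ^ k = (real q ^ k) ^ i" for k
    by (simp add: power_mult[symmetric] mult.commute)
  have v: "real (word_value q (concat (replicate i v))) = V * ((real q ^ length v) ^ i - 1)"
    and y: "real (word_value q (concat (replicate i y))) = Y * ((real q ^ length y) ^ i - 1)"
    using word_value_concat_replicate assms(3) by (auto simp: V_def Y_def)
  show ?thesis
    unfolding word_value_append length_append length_concat_replicate of_nat_add of_nat_mult of_nat_power v y i
    by (simp add: i power_add power_mult algebra_simps)
qed

text \<open>For nonempty \<open>v\<close> the quotient is the value of the periodic
  base-\<open>q\<close> fraction \<open>0.vvv...\<close>.\<close>

lemma word_value_quotient_le_1:
  assumes "set v \<subseteq> {..<q}" "q \<ge> 2"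
  shows "real (word_value q v) / (real q ^ length v - 1) \<le> 1"
proof (cases "v = []")
  case False
  have "real q ^ length v > 1" using False assms(2) by (intro one_less_power) auto
  moreover have "real (word_value q v) + 1 \<le> real q ^ length v"
    by (rule real_word_value_le[OF assms(1)])
  ultimately show ?thesis by (simp add: divide_le_eq_1)
qed simp

text \<open>The lower bound on \<open>\<alpha>\<close> makes \<open>r\<close> large when the pumped
  number is large. The last two facts on \<open>\<beta>\<close> work against each other: up to
  factors coprime to \<open>q\<close> it is a multiple of \<open>q ^ length z\<close>, yet its size
  exceeds that power by at most \<open>q ^ p\<close>.\<close>

lemma pumped_bounds:
  fixes u v x y z :: "nat list" and q :: nat
  defines "V \<equiv> real (word_value q v) / (real q ^ length v - 1)"
    and "Y \<equiv> real (word_value q y) / (real q ^ length y - 1)"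
  defines "\<alpha> \<equiv> real q ^ (length x + length z) * (real (word_value q u) + V)"
    and "\<beta> \<equiv> real q ^ length z * (real (word_value q x) + Y - real q ^ length x * V)"
  assumes q: "q \<ge> 2" and digits: "set (u @ v @ x @ y @ z) \<subseteq> {..<q}"
    and "v \<noteq> []" "hd (u @ v) \<noteq> 0" and p: "length (v @ x @ y) \<le> p"
  shows "\<alpha> > 0" "\<alpha> + \<beta> \<ge> 0" "\<bar>\<beta>\<bar> \<le> real q ^ (length z + p)"
    "real (word_value q (u @ v @ x @ y @ z)) \<le> \<alpha> * real q ^ (p + 1)"
    "\<exists>I::int. (real q ^ length v - 1) * (real q ^ length y - 1) * \<beta> = real q ^ length z * real_of_int I"
proof -
  define a b e m where "a = length v" "b = length y" "e = length x" "m = length z"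
  note lens = this
  have q1: "real q \<ge> 1" "real q > 0" using q by auto
  have qa: "real q ^ a > 1" using q \<open>v \<noteq> []\<close> by (intro one_less_power) (auto simp: lens)
  have qb: "real q ^ b \<ge> 1" using q by simp
  have V: "0 \<le> V" "V \<le> 1" "0 \<le> Y" "Y \<le> 1"
    using qa qb digits q word_value_quotient_le_1[of v q] word_value_quotient_le_1[of y q]
    unfolding V_def Y_def lens by simp_all
  have V': "word_value q v \<ge> q ^ (a - 1)" if "u = []"
    using word_value_ge[OF \<open>v \<noteq> []\<close>] \<open>hd (u @ v) \<noteq> 0\<close> that by (simp add: lens)
  \<comment> \<open>If \<open>u\<close> is empty, the nonzero leading digit belongs to
    \<open>v\<close>, and \<open>V\<close> is at least \<open>1 / q\<close>.\<close>
  have uv: "real q ^ length u \<le> (real (word_value q u) + V) * real q"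
  proof (cases "u = []")
    case True
    have "real q ^ (a - 1) \<le> real (word_value q v)"
      using V'[OF True] by (metis of_nat_le_iff of_nat_power)
    then have "real q ^ (a - 1) * real q \<le> real (word_value q v) * real q" using q1 by (intro mult_right_mono) auto
    moreover have "real q ^ (a - 1) * real q = real q ^ a"
      using \<open>v \<noteq> []\<close> by (metis lens(1) length_greater_0_conv power_minus_mult)
    ultimately have "1 \<le> V * real q" using qa by (simp add: V_def lens field_simps)
    then show ?thesis using True by simp
  next
    case False
    then have "q ^ (length u - 1) \<le> word_value q u" using word_value_ge \<open>hd (u @ v) \<noteq> 0\<close> by simp
    then have "real q ^ (length u - 1) \<le> real (word_value q u)" by (metis of_nat_le_iff of_nat_power)
    then have "real q ^ (length u - 1) \<le> real (word_value q u) + V" using V by linarith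
    then have "real q ^ (length u - 1) * real q \<le> (real (word_value q u) + V) * real q"
      using q1 by (intro mult_right_mono) auto
    moreover have "real q ^ (length u - 1) * real q = real q ^ length u"
      using False by (metis length_greater_0_conv power_minus_mult)
    ultimately show ?thesis by simp
  qed
  have "real q ^ length u > 0" using q1 by simp
  then have "(real (word_value q u) + V) * real q > 0" using uv by linarith
  then have "real (word_value q u) + V > 0" using q1 by (simp add: zero_less_mult_iff)
  then show "\<alpha> > 0" unfolding \<alpha>_def using q1 by simp
  \<comment> \<open>The contributions of \<open>V\<close> cancel, leaving only nonnegative
    terms.\<close>
  have "\<alpha> + \<beta> = real q ^ (e + m) * real (word_value q u) + real q ^ m * (real (word_value q x) + Y)"
    by (simp add: \<alpha>_def \<beta>_def lens power_add algebra_simps)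
  also have "\<dots> \<ge> 0" using V by (intro add_nonneg_nonneg mult_nonneg_nonneg) auto
  finally show "\<alpha> + \<beta> \<ge> 0" .
  have "real (word_value q x) + 1 \<le> real q ^ e"
    using digits real_word_value_le[of x q] by (simp add: lens)
  moreover have "real q ^ e * V \<le> real q ^ e * 1" using V by (intro mult_left_mono) auto
  moreover have "0 \<le> real q ^ e * V" using V by simp
  ultimately have "\<bar>real (word_value q x) + Y - real q ^ e * V\<bar> \<le> real q ^ e" using V by linarith
  then have "\<bar>\<beta>\<bar> \<le> real q ^ m * real q ^ e"
    unfolding \<beta>_def abs_mult lens(3,4)[symmetric] by (simp add: mult_left_mono)
  also have "\<dots> \<le> real q ^ (m + p)"
    unfolding power_add[symmetric] using q1 p by (intro power_increasing) (auto simp: lens)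
  finally show "\<bar>\<beta>\<bar> \<le> real q ^ (length z + p)" by (simp add: lens)
  have "length (u @ v @ x @ y @ z) = length u + (a + e + b) + m" by (simp add: lens)
  then have "real (word_value q (u @ v @ x @ y @ z)) \<le> real q ^ (length u + (a + e + b) + m)"
    using real_word_value_le[OF digits] by (simp only:)
  also have "\<dots> \<le> real q ^ (length u + p + e + m)"
    using q1 p by (intro power_increasing) (auto simp: lens)
  also have "\<dots> = real q ^ length u * real q ^ (p + e + m)" by (simp add: power_add)
  also have "\<dots> \<le> (real (word_value q u) + V) * real q * real q ^ (p + e + m)"
    using uv by (intro mult_right_mono) auto
  also have "\<dots> = \<alpha> * real q ^ (p + 1)" by (simp add: \<alpha>_def lens power_add)
  finally show "real (word_value q (u @ v @ x @ y @ z)) \<le> \<alpha> * real q ^ (p + 1)" .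
  \<comment> \<open>Obtained by clearing the denominators of \<open>V\<close> and \<open>Y\<close>
    in \<open>\<beta>\<close>.\<close>
  define I where "I = (int (word_value q x) * (int q ^ b - 1) + int (word_value q y)) * (int q ^ a - 1)
     - int q ^ e * int (word_value q v) * (int q ^ b - 1)"
  have "Y * (real q ^ b - 1) = real (word_value q y)"
  proof (cases "y = []")
    case False
    then have "real q ^ length y > 1" using q by (intro one_less_power) auto
    then show ?thesis by (simp add: Y_def lens)
  qed (simp add: lens)
  moreover have "V * (real q ^ a - 1) = real (word_value q v)"
    using qa by (simp add: V_def lens)
  moreover have "(real q ^ a - 1) * (real q ^ b - 1) * \<beta> = real q ^ m *
     ((real (word_value q x) * (real q ^ b - 1) + Y * (real q ^ b - 1)) * (real q ^ a - 1)
      - real q ^ e * (V * (real q ^ a - 1)) * (real q ^ b - 1))"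
    by (simp add: \<beta>_def lens algebra_simps)
  ultimately have "(real q ^ a - 1) * (real q ^ b - 1) * \<beta> = real q ^ m * real_of_int I"
    by (simp add: I_def)
  then show "\<exists>I::int. (real q ^ length v - 1) * (real q ^ length y - 1) * \<beta> = real q ^ length z * real_of_int I"
    unfolding lens by blast
qed

section \<open>Coprimality and divisibility by powers of \<open>q\<close>\<close>

text \<open>Let \<open>g\<close> be the product of the primes of \<open>q\<close> that do not divide
  \<open>u\<close>. Each prime of \<open>q\<close> then divides exactly one of \<open>D * g\<close>
  and \<open>u\<close>, hence not their sum.\<close>

lemma ex_coprime_linear:
  fixes D u q :: int
  assumes "coprime D u" "q > 0"
  shows "\<exists>g\<ge>0. coprime (D * g + u) q"
proof -
  define g where "g = \<Prod>{l \<in> prime_factors q. \<not> l dvd u}"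
  have "coprime (D * g + u) q"
  proof (rule ccontr)
    assume "\<not> coprime (D * g + u) q"
    then have "gcd (D * g + u) q \<noteq> 0" "\<not> is_unit (gcd (D * g + u) q)"
      using assms(2) by (simp_all add: coprime_iff_gcd_eq_1)
    then obtain l where "prime l" "l dvd gcd (D * g + u) q" using prime_divisor_exists by blast
    then have l: "prime l" "l dvd D * g + u" "l dvd q" by simp_all
    have "l \<in> prime_factors q" using l assms(2) by (simp add: in_prime_factors_iff)
    show False
    proof (cases "l dvd u")
      case True
      then have "l dvd D * g" using l(2) by (simp add: dvd_add_left_iff)
      moreover have "\<not> l dvd D" using assms(1) True l(1) by (meson coprime_common_divisor not_prime_unit)
      ultimately have "l dvd g" using l(1) prime_dvd_mult_iff by blast
      then obtain l' where "l' \<in> prime_factors q" "\<not> l' dvd u" "l dvd l'"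
        unfolding g_def using l(1) by (auto simp: prime_dvd_prod_iff)
      then show False using l(1) True by (metis in_prime_factors_imp_prime primes_dvd_imp_eq)
    next
      case False
      then have "l dvd g" unfolding g_def using \<open>l \<in> prime_factors q\<close> by (intro dvd_prodI) auto
      then show False using False l(2) by (simp add: dvd_add_right_iff)
    qed
  qed
  moreover have "g \<ge> 0" unfolding g_def
    by (intro prod_nonneg) (auto dest: in_prime_factors_imp_prime prime_ge_0_int)
  ultimately show ?thesis by blast
qed

text \<open>As \<open>q\<close> may be composite, a prime \<open>l\<close> is chosen whose
  multiplicity in \<open>x\<close> is below that in \<open>q ^ J\<close>. Comparing multiplicities
  of \<open>l\<close> bounds \<open>m - e * J\<close> by the multiplicity of \<open>l\<close> in
  \<open>C\<close>, which is less than \<open>C\<close>.\<close>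

lemma power_dvd_mult_power_bound:
  fixes q x C :: nat
  assumes "q ^ m dvd C * x ^ e" "\<not> q ^ J dvd x" "C > 0"
  shows "m \<le> e * J + C"
proof (cases "m \<le> e * J")
  case False
  have "x \<noteq> 0" using assms(2) by (metis dvd_0_right)
  have "q \<noteq> 0"
  proof
    assume "q = 0"
    then have "q ^ m = 0" using False by (simp add: power_0_left)
    then have "0 dvd C * x ^ e" using assms(1) by (simp only:)
    then show False using assms(3) \<open>x \<noteq> 0\<close> by simp
  qed
  obtain l where l: "prime l" "multiplicity l x < multiplicity l (q ^ J)"
    using multiplicity_le_imp_dvd[of "q ^ J" x] \<open>x \<noteq> 0\<close> \<open>q \<noteq> 0\<close> assms(2) by (metis not_le power_not_zero)
  define t where "t = multiplicity l q"
  have t: "multiplicity l (q ^ k) = k * t" for k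
    using l(1) \<open>q \<noteq> 0\<close> by (simp add: t_def prime_elem_multiplicity_power_distrib)
  have "t \<ge> 1" using l(2) by (cases t) (auto simp: t)
  have "m * t \<le> multiplicity l (C * x ^ e)"
    unfolding t[symmetric] using \<open>x \<noteq> 0\<close> assms(3) by (intro dvd_imp_multiplicity_le[OF assms(1)]) auto
  also have "\<dots> = multiplicity l C + e * multiplicity l x"
    using l(1) assms(3) \<open>x \<noteq> 0\<close>
    by (simp add: prime_elem_multiplicity_mult_distrib prime_elem_multiplicity_power_distrib)
  also have "\<dots> \<le> multiplicity l C + e * (J * t)"
    using l(2) by (intro add_left_mono mult_left_mono) (auto simp: t)
  finally have "(m - e * J) * t \<le> multiplicity l C" by (simp add: diff_mult_distrib algebra_simps)
  moreover have "(m - e * J) * 1 \<le> (m - e * J) * t" using \<open>t \<ge> 1\<close> by (intro mult_left_mono) auto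
  moreover have "multiplicity l C < C"
  proof -
    have "l ^ multiplicity l C \<le> C" using assms(3) by (intro dvd_imp_le multiplicity_dvd)
    moreover have "multiplicity l C < 2 ^ multiplicity l C" by (rule less_exp)
    moreover have "(2::nat) ^ multiplicity l C \<le> l ^ multiplicity l C"
      using l(1) prime_ge_2_nat by (intro power_mono) auto
    ultimately show ?thesis by linarith
  qed
  ultimately show ?thesis by linarith
qed simp

text \<open>Here \<open>n\<^sub>i = r T\<^sup>i + s\<close> for \<open>i = 0, 1\<close>, where \<open>T = q\<^sup>A\<close>. Since \<open>D (n\<^sub>1 + \<sigma>)\<close> is coprime to \<open>q\<close>,
  so is \<open>D (T - 1) (s + \<sigma>)\<close>. As \<open>\<beta>\<close> is essentially a multiple of \<open>q\<^sup>m\<close>, so is \<open>r\<^sup>d\<^sup>-\<^sup>1\<close>; the upper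
  bound for \<open>\<beta>\<close> then bounds first \<open>s + \<sigma>\<close>, next \<open>m\<close> (by the choice of \<open>n\<^sub>1\<close>
  modulo \<open>q\<^sup>J\<close>), and finally \<open>r\<close>.\<close>

lemma exponential_solution_bounded:
  fixes q A b d m p J D c1 c2 n0 n1 \<nu> k :: nat and u0 I :: int and r s \<sigma> \<beta> :: real
  assumes q: "q \<ge> 2" and A: "A > 0" and d: "d \<ge> 2" and D: "D > 0" and c12: "c1 > 0" "c2 > 0"
    and \<sigma>: "\<sigma> = of_int u0 / D"
    and r: "r > 0" and n0: "real n0 = r + s" and n1: "real n1 = r * real q ^ A + s"
    and n1_eq: "n1 = \<nu> + q ^ J * k"
    and cop: "coprime (int D * int n1 + u0) (int q)"
    and \<beta>: "\<beta> = real c1 / real c2 * r ^ (d - 1) * (s + \<sigma>)"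
    and \<beta>_le: "\<bar>\<beta>\<bar> \<le> real q ^ (m + p)"
    and \<beta>_dvd: "(real q ^ A - 1) * (real q ^ b - 1) * \<beta> = real q ^ m * real_of_int I"
    and "A \<le> p" "b > 0"
    and S: "S = c2 * (q ^ p * D) ^ d * q ^ p"
    and \<nu>: "int D * int \<nu> + u0 > int S"
    and J: "int q ^ J > int q ^ p * (int D * int \<nu> + u0) + int S"
  shows "r \<le> real (S * q ^ ((d - 1) * J + c1))"
proof -
  define T where "T = q ^ A"
  have "T > 1" unfolding T_def using q A by (intro one_less_power) auto
  have T_real: "real q ^ A = real T" by (simp add: T_def)
  \<comment> \<open>\<open>K\<close> clears denominators: \<open>R = K r\<close> and
    \<open>s' = K (s + \<sigma>)\<close> are integers.\<close>
  define K where "K = (int T - 1) * int D"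
  have "K > 0" using \<open>T > 1\<close> D by (simp add: K_def)
  define R where "R = int D * (int n1 - int n0)"
  define s' where "s' = (int T - 1) * (int D * int n1 + u0) - int T * R"
  have K_real: "real_of_int K = (real T - 1) * real D" by (simp add: K_def)
  have diff: "real n1 - real n0 = r * (real T - 1)" using n0 n1 by (simp add: T_real algebra_simps)
  have R_real: "real_of_int R = real_of_int K * r"
    unfolding K_real by (simp add: R_def diff)
  have "real D * \<sigma> = of_int u0" using D by (simp add: \<sigma>)
  have "real_of_int s' = (real T - 1) * (real D * real n1 + real D * \<sigma>) - real T * (real_of_int K * r)"
    unfolding R_real[symmetric] \<open>real D * \<sigma> = of_int u0\<close> by (simp add: s'_def)
  also have "\<dots> = real_of_int K * (s + \<sigma>)"
    unfolding n1 T_real K_real by (simp add: algebra_simps)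
  finally have s'_real: "real_of_int s' = real_of_int K * (s + \<sigma>)" .
  have "R > 0" using R_real \<open>K > 0\<close> r by (metis mult_pos_pos of_int_0_less_iff)
  have q_dvd_T: "int q dvd int T" using A by (simp add: T_def dvd_power)
  have cop_T1: "coprime (int q ^ k' - 1) (int q)" if "k' > 0" for k'
  proof -
    have "int q dvd int q ^ k'" using that by (simp add: dvd_power)
    then have "gcd (int q ^ k' - 1) (int q) dvd int q ^ k' - (int q ^ k' - 1)"
      by (meson dvd_diff dvd_trans gcd_dvd1 gcd_dvd2)
    then show ?thesis by (simp add: coprime_iff_gcd_eq_1)
  qed
  have cop_T: "coprime (int T - 1) (int q)" using cop_T1[OF A] by (simp add: T_def)
  then have "coprime ((int T - 1) * (int D * int n1 + u0)) (int q)" using cop by simp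
  \<comment> \<open>Since \<open>q\<close> divides \<open>T\<close>, modulo \<open>q\<close> the
    number \<open>s'\<close> is \<open>(T - 1) (D n1 + u0)\<close>.\<close>
  moreover have "gcd s' (int q) dvd s' + int T * R"
    using q_dvd_T by (meson dvd_add dvd_mult2 dvd_trans gcd_dvd1 gcd_dvd2)
  then have "gcd s' (int q) dvd (int T - 1) * (int D * int n1 + u0)" by (simp add: s'_def)
  ultimately have "is_unit (gcd s' (int q))" by (meson coprime_common_divisor gcd_dvd2)
  then have cop_s': "coprime s' (int q)" by (simp add: coprime_iff_gcd_eq_1 is_unit_gcd)
  have "s' \<noteq> 0" using cop_s' q by auto
  have "K \<le> int (q ^ p * D)"
  proof -
    have "T \<le> q ^ p" unfolding T_def using q \<open>A \<le> p\<close> by (intro power_increasing) auto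
    then have "K \<le> int (q ^ p) * int D" unfolding K_def by (intro mult_right_mono) linarith+
    then show ?thesis by simp
  qed
  then have K_pow: "real_of_int K ^ d * real c2 * real q ^ p \<le> real S"
  proof -
    have "real_of_int K \<le> real (q ^ p * D)" using \<open>K \<le> int (q ^ p * D)\<close> by linarith
    then have "real_of_int K ^ d \<le> real (q ^ p * D) ^ d" using \<open>K > 0\<close> by (intro power_mono) auto
    then have "real_of_int K ^ d * (real c2 * real q ^ p) \<le> real (q ^ p * D) ^ d * (real c2 * real q ^ p)"
      by (intro mult_right_mono) auto
    then show ?thesis by (simp add: S mult_ac)
  qed
  have K_d: "real_of_int K ^ d = real_of_int K ^ (d - 1) * real_of_int K"
    using d by (metis One_nat_def Suc_1 Suc_leD Suc_le_eq power_minus_mult)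
  \<comment> \<open>Of the \<open>d\<close> factors \<open>K\<close>, all but one turn
    \<open>r\<close> into \<open>R\<close>, and the last turns \<open>s + \<sigma>\<close> into
    \<open>s'\<close>.\<close>
  have key: "real c1 * real_of_int R ^ (d - 1) * real_of_int s' = real c2 * real_of_int K ^ d * \<beta>"
    unfolding R_real s'_real \<beta> K_d using c12 by (simp add: power_mult_distrib)
  have "real_of_int ((int c1 * R ^ (d - 1)) * (s' * (int q ^ A - 1) * (int q ^ b - 1))) =
      real c2 * real_of_int K ^ d * ((real q ^ A - 1) * (real q ^ b - 1) * \<beta>)"
    using arg_cong[OF key, of "\<lambda>t. (real q ^ A - 1) * (real q ^ b - 1) * t"] by (simp add: mult_ac)
  also have "\<dots> = real_of_int (int q ^ m * (int c2 * K ^ d * I))"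
    unfolding \<beta>_dvd by simp
  finally have "(int c1 * R ^ (d - 1)) * (s' * (int q ^ A - 1) * (int q ^ b - 1)) = int q ^ m * (int c2 * K ^ d * I)"
    by (simp only: of_int_eq_iff)
  then have "int q ^ m dvd (int c1 * R ^ (d - 1)) * (s' * (int q ^ A - 1) * (int q ^ b - 1))" by simp
  moreover have "coprime (int q ^ m) (s' * (int q ^ A - 1) * (int q ^ b - 1))"
    using cop_s' cop_T1[OF A] cop_T1[OF \<open>b > 0\<close>] by (simp add: coprime_commute)
  ultimately have dvd: "int q ^ m dvd int c1 * R ^ (d - 1)"
    by (simp add: coprime_dvd_mult_left_iff)
  have "int c1 * R ^ (d - 1) > 0" using c12 \<open>R > 0\<close> by simp
  then have ge: "int q ^ m \<le> int c1 * R ^ (d - 1)" using dvd zdvd_imp_le by blast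
  have abs_key: "real c1 * real_of_int R ^ (d - 1) * \<bar>real_of_int s'\<bar> = real c2 * real_of_int K ^ d * \<bar>\<beta>\<bar>"
    using arg_cong[OF key, of abs] \<open>R > 0\<close> \<open>K > 0\<close> by (simp add: abs_mult)
  also have "\<dots> \<le> real c2 * real_of_int K ^ d * real q ^ (m + p)"
    using \<beta>_le \<open>K > 0\<close> by (intro mult_left_mono) auto
  also have "\<dots> = (real_of_int K ^ d * real c2 * real q ^ p) * real q ^ m" by (simp add: power_add)
  also have "\<dots> \<le> real S * real q ^ m" using K_pow by (intro mult_right_mono) auto
  finally have upper: "real c1 * real_of_int R ^ (d - 1) * \<bar>real_of_int s'\<bar> \<le> real S * real q ^ m" .
  \<comment> \<open>The divisibility gives a lower bound for \<open>c1 R^(d-1)\<close>; set against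
    the upper bound for its product with \<open>\<bar>s'\<bar>\<close>, it leaves
    \<open>\<bar>s'\<bar> \<le> S\<close>.\<close>
  have "real q ^ m \<le> real c1 * real_of_int R ^ (d - 1)"
  proof -
    have "real_of_int (int q ^ m) \<le> real_of_int (int c1 * R ^ (d - 1))"
      using ge by (simp only: of_int_le_iff)
    then show ?thesis by simp
  qed
  then have "real q ^ m * \<bar>real_of_int s'\<bar> \<le> real q ^ m * real S"
    using upper mult_right_mono[of "real q ^ m" "real c1 * real_of_int R ^ (d - 1)" "\<bar>real_of_int s'\<bar>"]
    by (simp add: mult.commute)
  then have "\<bar>real_of_int s'\<bar> \<le> real S" using q by simp
  then have s'_le: "\<bar>s'\<bar> \<le> int S" by linarith
  \<comment> \<open>Modulo \<open>q ^ J\<close>, \<open>n1\<close> is \<open>\<nu>\<close>. If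
    \<open>q ^ J\<close> divided \<open>R\<close>, it would divide
    \<open>(T - 1) (D \<nu> + u0) - s'\<close>, but the conditions on \<open>\<nu>\<close> and
    \<open>J\<close> put this number strictly between 0 and \<open>q ^ J\<close>.\<close>
  have "\<not> int q ^ J dvd R"
  proof
    assume "int q ^ J dvd R"
    then have "int q ^ J dvd int T * R + (int T - 1) * (int D * (int q ^ J * int k)) * (- 1)"
      by simp
    moreover have "int T * R + (int T - 1) * (int D * (int q ^ J * int k)) * (- 1) =
        (int T - 1) * (int D * int \<nu> + u0) - s'"
      by (simp add: s'_def n1_eq algebra_simps)
    ultimately have dvd_diff: "int q ^ J dvd (int T - 1) * (int D * int \<nu> + u0) - s'" by simp
    define E where "E = int D * int \<nu> + u0"
    define G where "G = (int T - 1) * E"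
    define H where "H = int q ^ p * E"
    have E: "E > int S" using \<nu> by (simp add: E_def)
    have "1 * E \<le> G" unfolding G_def using \<open>T > 1\<close> E by (intro mult_right_mono) auto
    then have "G - s' > 0" using s'_le E by linarith
    then have "int q ^ J \<le> G - s'"
      using dvd_diff zdvd_imp_le unfolding G_def E_def by blast
    moreover have "int T \<le> int q ^ p"
      unfolding T_def of_nat_power using q \<open>A \<le> p\<close> by (intro power_increasing) auto
    then have "G \<le> H"
      unfolding G_def H_def using E by (intro mult_right_mono) linarith+
    moreover have "int q ^ J > H + int S" using J by (simp add: H_def E_def)
    ultimately show False using s'_le by linarith
  qed
  moreover obtain R' where R': "R = int R'" using \<open>R > 0\<close> zero_less_imp_eq_int by blast
  ultimately have "\<not> int (q ^ J) dvd int R'" by simp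
  moreover have "int (q ^ m) dvd int (c1 * R' ^ (d - 1))" using dvd R' by simp
  ultimately have "\<not> q ^ J dvd R'" "q ^ m dvd c1 * R' ^ (d - 1)"
    by (simp_all only: int_dvd_int_iff not_False_eq_True)
  then have m: "m \<le> (d - 1) * J + c1"
    using power_dvd_mult_power_bound c12(1) by blast
  have "R \<ge> 1" "K \<ge> 1" "\<bar>s'\<bar> \<ge> 1" using \<open>R > 0\<close> \<open>K > 0\<close> \<open>s' \<noteq> 0\<close> by auto
  have "r \<le> real_of_int K * r" using \<open>K \<ge> 1\<close> r by simp
  also have "\<dots> = real_of_int R" by (simp add: R_real)
  also have "\<dots> \<le> real_of_int R ^ (d - 1)" using \<open>R \<ge> 1\<close> d by (intro self_le_power) auto
  also have "\<dots> = 1 * real_of_int R ^ (d - 1) * 1" by simp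
  also have "\<dots> \<le> real c1 * real_of_int R ^ (d - 1) * \<bar>real_of_int s'\<bar>"
    using \<open>\<bar>s'\<bar> \<ge> 1\<close> c12 \<open>R > 0\<close> by (intro mult_mono) auto
  also have "\<dots> \<le> real S * real q ^ m" by (rule upper)
  also have "\<dots> \<le> real S * real q ^ ((d - 1) * J + c1)"
    using m q by (intro mult_left_mono power_increasing) auto
  finally show ?thesis by simp
qed

subsection \<open>The choice of the pumped number\<close>

lemma poly_map_poly_of_rat:
  "poly (map_poly of_rat f :: 'a::field_char_0 poly) (of_rat x) = of_rat (poly f x)"
  by (induction f) (simp_all add: map_poly_pCons of_rat_add of_rat_mult)

lemma lead_coeff_nonneg_if_nonneg_on_nats:
  fixes f :: "real poly"
  assumes "\<And>n::nat. poly f (real n) \<ge> 0"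
  shows "lead_coeff f \<ge> 0"
proof (rule ccontr)
  assume "\<not> lead_coeff f \<ge> 0"
  then have "lead_coeff (- f) > 0" unfolding degree_minus coeff_minus by simp
  then obtain X where X: "\<And>x. x \<ge> X \<Longrightarrow> poly (- f) x > 0" using poly_eventually_pos by blast
  obtain n :: nat where "real n \<ge> X" using real_arch_simple by blast
  then show False using X[of "real n"] assms[of n] by simp
qed

lemma coprime_add_mult_self:
  fixes x q :: int
  assumes "coprime x q"
  shows "coprime (x + q * k) q"
proof (cases "q = 0")
  case False
  then show ?thesis using assms coprime_mod_left_iff[of q "x + q * k"] coprime_mod_left_iff[of q x] by simp
qed (use assms in simp)

lemma ex_power_gt_int:
  assumes "q \<ge> 2"
  shows "\<exists>J. x < int q ^ J"
proof -
  have "x \<le> int (nat x)" by simp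
  also have "\<dots> < int (2 ^ nat x)" using less_exp[of "nat x"] by (simp only: of_nat_less_iff)
  also have "\<dots> \<le> int q ^ nat x" unfolding of_nat_power using assms by (intro power_mono) auto
  finally show ?thesis by blast
qed

lemma rat_positive_fraction:
  assumes "(t::rat) > 0"
  obtains k l :: nat where "k > 0" "l > 0" "t = of_nat k / of_nat l"
proof -
  obtain x y where xy: "quotient_of t = (x, y)" by (cases "quotient_of t")
  then have "y > 0" "t = of_int x / of_int y"
    using quotient_of_denom_pos quotient_of_div by blast+
  moreover from this have "x > 0" using assms by (simp add: zero_less_divide_iff)
  ultimately show ?thesis using that[of "nat x" "nat y"] by simp
qed

theorem theorem5:
  fixes f :: "rat poly" and q :: nat
  assumes "natural_poly f"
    and "degree f \<ge> 2"
    and "q \<ge> 2"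
  shows "\<not> context_free (base_rep q ` {m::nat. \<exists>n::nat. poly f (of_nat n) = of_nat m})"
proof
  define L where "L = base_rep q ` {m::nat. \<exists>n::nat. poly f (of_nat n) = of_nat m}"
  assume "context_free (base_rep q ` {m::nat. \<exists>n::nat. poly f (of_nat n) = of_nat m})"
  then have "context_free L" by (simp add: L_def)
  note q = \<open>q \<ge> 2\<close>
  define F :: "real poly" where "F = map_poly of_rat f"
  define d where "d = degree f"
  have d: "d \<ge> 2" using assms(2) by (simp add: d_def)
  have deg_F: "degree F = d" unfolding F_def d_def by (rule degree_map_poly) simp
  have coeff_F: "coeff F i = of_rat (coeff f i)" for i by (simp add: F_def coeff_map_poly)
  have F_nat: "poly F (real n) = real m \<longleftrightarrow> poly f (of_nat n) = of_nat m" for n m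
  proof -
    have "poly F (real n) = of_rat (poly f (of_nat n))"
      unfolding F_def poly_map_poly_of_rat[symmetric] by simp
    moreover have "real m = of_rat (of_nat m)" by simp
    ultimately show ?thesis by (simp only: of_rat_eq_iff)
  qed
  have ex_value: "\<exists>m. poly F (real n) = real m" for n
    using assms(1) unfolding natural_poly_def F_nat by (auto elim: Nats_cases)
  define c where "c = lead_coeff F"
  have "c \<ge> 0" unfolding c_def
    by (rule lead_coeff_nonneg_if_nonneg_on_nats) (use ex_value of_nat_0_le_iff in metis)
  moreover have "c \<noteq> 0" using d deg_F by (auto simp: c_def)
  ultimately have c: "c > 0" by simp
  have c_rat: "c = of_rat (lead_coeff f)" by (simp add: c_def coeff_F deg_F d_def)
  define \<sigma> where "\<sigma> = coeff F (d - 1) / (d * c)"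
  define \<sigma>' where "\<sigma>' = coeff f (d - 1) / (of_nat d * lead_coeff f)"
  have \<sigma>_rat: "\<sigma> = of_rat \<sigma>'"
    by (simp add: \<sigma>_def \<sigma>'_def coeff_F c_rat of_rat_divide of_rat_mult)
  \<comment> \<open>The fraction is in lowest terms, as the choice of \<open>g\<close> below
    requires.\<close>
  obtain u0 D' where uD: "quotient_of \<sigma>' = (u0, D')" by (cases "quotient_of \<sigma>'")
  define D where "D = nat D'"
  have D': "D' > 0" "\<sigma>' = of_int u0 / of_int D'" "coprime u0 D'"
    using uD quotient_of_denom_pos quotient_of_div quotient_of_coprime by blast+
  then have D: "D > 0" "coprime (int D) u0" by (simp_all add: D_def coprime_commute)
  have "D' = int D" using D'(1) by (simp add: D_def)
  then have \<sigma>: "\<sigma> = of_int u0 / real D" by (simp add: \<sigma>_rat D'(2) of_rat_divide)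
  have "of_nat d * lead_coeff f > 0" using c d by (simp add: c_rat)
  then obtain c1 c2 :: nat where c12: "c1 > 0" "c2 > 0" "of_nat d * lead_coeff f = of_nat c1 / of_nat c2"
    by (rule rat_positive_fraction)
  have dc: "real d * c = real c1 / real c2"
    using arg_cong[OF c12(3), of "of_rat :: rat \<Rightarrow> real"] by (simp add: c_rat of_rat_mult of_rat_divide)
  obtain p where p: "\<forall>w\<in>L. length w > p \<longrightarrow>
      (\<exists>u v x y z. w = u @ v @ x @ y @ z \<and> length (v @ x @ y) \<le> p \<and> v \<noteq> [] \<and>
         d dvd length v + length y \<and>
         (\<forall>i. u @ concat (replicate i v) @ x @ concat (replicate i y) @ z \<in> L))"
    using pumping_lemma_nonempty_left[OF \<open>context_free L\<close>, of d] d by auto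
  \<comment> \<open>\<open>S\<close>, \<open>\<nu>\<close> and \<open>J\<close> depend only on
    \<open>f\<close>, \<open>q\<close> and \<open>p\<close>; they are fixed before the word to be
    pumped is chosen.\<close>
  define S where "S = c2 * (q ^ p * D) ^ d * q ^ p"
  obtain g where g: "g \<ge> 0" "coprime (int D * g + u0) (int q)"
    using ex_coprime_linear[OF D(2), of "int q"] q by auto
  \<comment> \<open>Adding a multiple of \<open>q\<close> keeps \<open>D \<nu> + u0\<close> coprime
    to \<open>q\<close> while making it exceed \<open>S\<close>.\<close>
  define \<nu> where "\<nu> = nat g + q * (S + nat \<bar>u0\<bar> + 1)"
  have \<nu>: "int D * int \<nu> + u0 > int S"
  proof -
    have "1 * (S + nat \<bar>u0\<bar> + 1) \<le> q * (S + nat \<bar>u0\<bar> + 1)" using q by (intro mult_right_mono) auto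
    then have "S + nat \<bar>u0\<bar> + 1 \<le> \<nu>" by (simp add: \<nu>_def)
    moreover have "1 * \<nu> \<le> D * \<nu>" using D by (intro mult_right_mono) auto
    ultimately have "S + nat \<bar>u0\<bar> + 1 \<le> D * \<nu>" by linarith
    then show ?thesis by (simp only: of_nat_mult[symmetric])
  qed
  obtain J where J: "int q ^ p * (int D * int \<nu> + u0) + int S < int q ^ J"
    using ex_power_gt_int[OF q] by blast
  define M where "M = (d - 1) * J + c1"
  have deg_pos: "degree F > 0" using deg_F d by simp
  obtain X where X: "X \<ge> 0" "\<And>x y. 0 \<le> x \<Longrightarrow> x < y \<Longrightarrow> X \<le> y \<Longrightarrow> poly F x < poly F y"
    using poly_eventually_increasing[of F] c deg_pos unfolding c_def by blast
  have inj: "real n = t" if "poly F (real n) = poly F t" "t \<ge> X" for n t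
    using X(2)[of "real n" t] X(2)[of t "real n"] X(1) that by (cases "real n" t rule: linorder_cases) auto
  \<comment> \<open>For \<open>r > r0\<close>, the first entry will give
    \<open>r + s \<ge> X\<close>, and the second contradicts the final upper bound for
    \<open>r\<close>.\<close>
  define r0 where "r0 = max (2 * (X + \<bar>\<sigma>\<bar>)) (real (S * q ^ M))"
  \<comment> \<open>The first entry forces \<open>r > r0\<close> through the bound on
    \<open>\<alpha>\<close>; the second makes the representation longer than
    \<open>p\<close>.\<close>
  define B where "B = max (c * r0 ^ d * real q ^ (p + 1)) (real q ^ p)"
  obtain Y where Y: "\<And>t. t \<ge> Y \<Longrightarrow> poly F t > B"
    using poly_eventually_gt[of F B] c deg_pos unfolding c_def by blast
  obtain k :: nat where k: "real k \<ge> Y" using real_arch_simple by blast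
  define n1 where "n1 = \<nu> + q ^ J * k"
  have "k \<le> q ^ J * k" using q by simp
  then have "n1 \<ge> k" unfolding n1_def by linarith
  then have n1_large: "poly F (real n1) > B" using k by (intro Y) linarith
  obtain N where N: "poly F (real n1) = real N" using ex_value by blast
  have cop: "coprime (int D * int n1 + u0) (int q)"
  proof -
    \<comment> \<open>Needed so that \<open>n1\<close> and \<open>\<nu>\<close> agree modulo
      \<open>q\<close>.\<close>
    have "J \<noteq> 0"
    proof
      assume "J = 0"
      have "int D * int \<nu> + u0 > 0" using \<nu> by linarith
      then have "int q ^ p * (int D * int \<nu> + u0) \<ge> 1" using q by (simp add: int_one_le_iff_zero_less)
      then show False using J \<open>J = 0\<close> by simp
    qed
    then have "q ^ J = q * q ^ (J - 1)" by (cases J) auto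
    then have "int D * int n1 + u0 =
        (int D * g + u0) + int q * (int D * (int (S + nat \<bar>u0\<bar> + 1) + int q ^ (J - 1) * int k))"
      using g(1) by (simp add: n1_def \<nu>_def algebra_simps)
    then show ?thesis using coprime_add_mult_self[OF g(2)] by (simp only:)
  qed
  define w where "w = base_rep q N"
  have "w \<in> L" using N F_nat by (auto simp: w_def L_def)
  have w_digits: "set w \<subseteq> {..<q}" using set_base_rep[OF q] by (simp add: w_def)
  have w_value: "word_value q w = N" by (simp add: w_def word_value_base_rep)
  have "real N > real q ^ p" using n1_large N by (simp add: B_def)
  moreover have "real N + 1 \<le> real q ^ length w" using real_word_value_le[OF w_digits] unfolding w_value .
  ultimately have "real q ^ p < real q ^ length w" by linarith
  then have "length w > p" using q by (simp add: power_strict_increasing_iff)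
  then obtain u v x y z where w: "w = u @ v @ x @ y @ z" "length (v @ x @ y) \<le> p" "v \<noteq> []"
      "d dvd length v + length y"
      "\<And>i. u @ concat (replicate i v) @ x @ concat (replicate i y) @ z \<in> L"
    using p \<open>w \<in> L\<close> by meson
  have "real N > 0" using \<open>real N > real q ^ p\<close> by (meson le_less_trans of_nat_0_le_iff zero_le_power)
  then have "hd w \<noteq> 0" using base_rep_no_leading_zero[of N q] by (simp add: w_def)
  then have hd_uv: "hd (u @ v) \<noteq> 0" using w(1,3) by (cases u) auto
  define a b m where "a = length v" and "b = length y" and "m = length z"
  note lens = this
  define V where "V = real (word_value q v) / (real q ^ length v - 1)"
  define Y' where "Y' = real (word_value q y) / (real q ^ length y - 1)"
  define \<alpha> where "\<alpha> = real q ^ (length x + length z) * (real (word_value q u) + V)"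
  define \<beta> where "\<beta> = real q ^ length z * (real (word_value q x) + Y' - real q ^ length x * V)"
  define \<gamma> where "\<gamma> = real (word_value q z) - real q ^ length z * Y'"
  note bounds = pumped_bounds[of q u v x y z p, OF q w_digits[unfolded w(1)] w(3) hd_uv w(2),
    folded V_def Y'_def, folded \<alpha>_def \<beta>_def]
  \<comment> \<open>The division is exact because the pumped length is a multiple of
    \<open>d\<close>; hence the top exponent is \<open>d * A\<close>.\<close>
  define A where "A = (a + b) div d"
  have dA: "d * A = a + b" using w(4) by (simp add: A_def lens)
  have "a > 0" using w(3) by (simp add: lens)
  then have A: "A > 0" using dA by (cases A) auto
  have "b < d * A" using dA \<open>a > 0\<close> by simp
  have "a + b \<le> p" using w(2) by (simp add: lens)
  have "A \<le> d * A" using d by simp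
  then have "A \<le> p" using dA \<open>a + b \<le> p\<close> by linarith
  have "\<exists>n. poly F (real n) = real (word_value q (u @ concat (replicate i v) @ x @ concat (replicate i y) @ z))" for i
  proof -
    obtain m n where "u @ concat (replicate i v) @ x @ concat (replicate i y) @ z = base_rep q m"
      "poly f (of_nat n) = of_nat m" using w(5)[of i] by (auto simp: L_def)
    then show ?thesis using F_nat by (auto simp: word_value_base_rep)
  qed
  then obtain n where n: "\<And>i. poly F (real (n i)) =
      real (word_value q (u @ concat (replicate i v) @ x @ concat (replicate i y) @ z))"
    by metis
  have vals: "poly F (real (n i)) = \<alpha> * (real q ^ i) ^ (d * A) + \<beta> * (real q ^ i) ^ b + \<gamma>" for i
    unfolding n dA word_value_pumped[OF q] \<alpha>_def \<beta>_def \<gamma>_def V_def Y'_def lens ..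
  \<comment> \<open>Each pumped part taken once gives back the original word.\<close>
  have F_n1: "poly F (real (n 1)) = poly F (real n1)"
    unfolding n N using w_value w(1) by simp
  obtain r s where rs: "r > 0" "c * r ^ d = \<alpha>"
      "\<And>i. poly F (r * (real q ^ i) ^ A + s) = poly F (real (n i))"
      "s = - \<sigma> \<or> b = (d - 1) * A \<and> \<beta> = d * c * r ^ (d - 1) * (s + \<sigma>)"
    using polynomial_values_at_exponentials[of F q A b \<alpha> n \<beta> \<gamma>] d c q A \<open>b < d * A\<close> bounds(1) vals
    unfolding deg_F c_def \<sigma>_def by blast
  have "r > r0"
  proof (rule ccontr)
    assume "\<not> r > r0"
    then have "c * r ^ d * real q ^ (p + 1) \<le> c * r0 ^ d * real q ^ (p + 1)"
      using rs(1) c by (intro mult_right_mono mult_left_mono power_mono) auto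
    moreover have "real N \<le> \<alpha> * real q ^ (p + 1)"
      using bounds(4) w_value w(1) by simp
    ultimately show False using n1_large N rs(2) by (simp add: B_def)
  qed
  \<comment> \<open>Follows from \<open>\<alpha> + \<beta> \<ge> 0\<close>; it excludes that \<open>r + s\<close> is a large negative number.\<close>
  have "0 \<le> r + 2 * (s + \<sigma>)"
  proof (cases "s = - \<sigma>")
    case False
    then have \<beta>: "\<beta> = d * c * r ^ (d - 1) * (s + \<sigma>)" using rs(4) by blast
    have "r ^ d = r ^ (d - 1) * r" using d by (cases d) auto
    then have "\<alpha> + \<beta> = c * r ^ (d - 1) * (r + d * (s + \<sigma>))"
      using rs(2) by (simp add: \<beta> algebra_simps)
    moreover have "c * r ^ (d - 1) > 0" using c rs(1) by simp
    ultimately have "r + d * (s + \<sigma>) \<ge> 0"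
      using bounds(2) by (metis not_le mult_pos_neg)
    show ?thesis
    proof (cases "s + \<sigma> \<ge> 0")
      case False
      have "real d * (s + \<sigma>) \<le> 2 * (s + \<sigma>)" using False d by (intro mult_right_mono_neg) auto
      then have "r + real d * (s + \<sigma>) \<le> r + 2 * (s + \<sigma>)" by (rule add_left_mono)
      then show ?thesis by (rule order_trans[OF \<open>r + d * (s + \<sigma>) \<ge> 0\<close>])
    qed (use rs(1) in simp)
  qed (use rs(1) in simp)
  moreover have "r > 2 * (X + \<bar>\<sigma>\<bar>)" using \<open>r > r0\<close> by (simp add: r0_def)
  \<comment> \<open>One half of \<open>r\<close> absorbs a possibly negative
    \<open>s + \<sigma>\<close>, and the other half exceeds
    \<open>X + \<bar>\<sigma>\<bar>\<close>.\<close>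
  ultimately have "r + s \<ge> X" unfolding distrib_left by linarith
  \<comment> \<open>Beyond \<open>X\<close> equal values of \<open>F\<close> force equal arguments,
    so the identities for \<open>i = 0\<close> and \<open>i = 1\<close> pass from values to the
    numbers themselves.\<close>
  have n0: "real (n 0) = r + s" by (rule inj) (use rs(3)[of 0] \<open>r + s \<ge> X\<close> in simp_all)
  have "r * real q ^ A + s \<ge> X"
  proof -
    have "r * 1 \<le> r * real q ^ A" using rs(1) q by (intro mult_left_mono) auto
    then show ?thesis using \<open>r + s \<ge> X\<close> by linarith
  qed
  then have n1: "real n1 = r * real q ^ A + s"
    by (intro inj) (use rs(3)[of 1] F_n1 in simp_all)
  note bounded = exponential_solution_bounded[OF q A d D(1) c12(1,2) \<sigma> rs(1) n0 n1 n1_def cop _ _ _ \<open>A \<le> p\<close> _ S_def \<nu> J]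
  have "r \<le> real (S * q ^ M)"
  proof (cases "s = - \<sigma>")
    case True
    \<comment> \<open>With \<open>s + \<sigma> = 0\<close> the conditions hold for zero data.
      Coprimality excludes this case: the integer \<open>s'\<close> in the proof of the bound would
      be zero and yet coprime to \<open>q\<close>.\<close>
    show ?thesis unfolding M_def
      by (rule bounded[where \<beta> = 0 and I = 0 and m = 0 and b = 1]) (use True in simp_all)
  next
    case False
    then have b: "b = (d - 1) * A" and \<beta>: "\<beta> = d * c * r ^ (d - 1) * (s + \<sigma>)" using rs(4) by auto
    have "d * A = (d - 1) * A + A" using d by (cases d) auto
    \<comment> \<open>The bound expects the factor \<open>q^A - 1\<close> where pumping provides
      \<open>q^a - 1\<close>.\<close>
    then have "a = A" using dA b by simp
    obtain I :: int where I: "(real q ^ a - 1) * (real q ^ b - 1) * \<beta> = real q ^ m * real_of_int I"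
      using bounds(5) unfolding lens by blast
    show ?thesis unfolding M_def
    proof (rule bounded)
      show "\<beta> = real c1 / real c2 * r ^ (d - 1) * (s + \<sigma>)" using \<beta> dc by simp
      show "\<bar>\<beta>\<bar> \<le> real q ^ (m + p)" using bounds(3) by (simp add: lens)
      show "(real q ^ A - 1) * (real q ^ b - 1) * \<beta> = real q ^ m * real_of_int I"
        using I \<open>a = A\<close> by simp
      show "b > 0" using b A d by simp
    qed
  qed
  then show False using \<open>r > r0\<close> by (simp add: r0_def)
qed

end
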